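(* Let $k$ be a commutative ring, $i:B\to A$ a morphism of $k$-algebras, and $C$ a $k$-coalgebra. Then $A$ is a $C$-Galois extension of $B$ if and only if there exist a right-right entwining structure $(A,C,\psi)$ and a grouplike element $x$ of the associated $A$-coring $A\otimes C$ such that $A^{\mathrm{co}\,A\otimes C}=B$ and $(A\otimes C,x)$ is a Galois coring.
   Context: $\otimes=\otimes_k$. $C$-Galois extension: $A$ is a $C$-Galois extension of $B$ if (1) $A$ is a right $C$-comodule, with coaction $\rho(a)=a_{[0]}\otimes a_{[1]}\in A\otimes C$; (2) the map $\mathrm{can}:A\otimes_B A\to A\otimes C$, $\mathrm{can}(a\otimes_B a')=aa'_{[0]}\otimes a'_{[1]}$ is (well defined and) an isomorphism; (3) $B=\{a\in A\mid\rho(a)=a\rho(1)\}$ (where $B$ is viewed in $A$ via $i$). Entwining structure: a (right-right) entwining structure is a $k$-linear map $\psi:C\otimes A\to A\otimes C$, written $\psi(c\otimes a)=a_\psi\otimes c^\psi=a_\Psi\otimes c^\Psi$ (summation understood), such that for all $a,b\in A$, $c\in C$: $(ab)_\psi\otimes c^\psi=a_\psi b_\Psi\otimes c^{\psi\Psi}$; $(1_A)_\psi\otimes c^\psi=1_A\otimes c$; $a_\psi\otimes\Delta_C(c^\psi)=a_{\psi\Psi}\otimes c_{(1)}^{\Psi}\otimes c_{(2)}^{\psi}$; $\varepsilon_C(c^\psi)a_\psi=\varepsilon_C(c)a$. The associated $A$-coring is $\mathcal{C}=A\otimes C$ with bimodule structure $a'(b\otimes c)a=a'ba_\psi\otimes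 c^\psi$, comultiplication $I_A\otimes\Delta_C$ (identifying $(A\otimes C)\otimes_A(A\otimes C)\cong A\otimes C\otimes C$) and counit $I_A\otimes\varepsilon_C$. Galois coring: for an $A$-coring $\mathcal{C}$, an element $x\in\mathcal{C}$ is grouplike if $\Delta_{\mathcal{C}}(x)=x\otimes_A x$ and $\varepsilon_{\mathcal{C}}(x)=1_A$. Then $A^{\mathrm{co}\mathcal{C}}=\{b\in A\mid bx=xb\}$, and $(\mathcal{C},x)$ is a Galois coring if, with $B=A^{\mathrm{co}\mathcal{C}}$, the map $A\otimes_B A\to\mathcal{C}$, $a\otimes_B a'\mapsto axa'$ is an isomorphism. *)

theory Defs
  imports "HOL-Algebra.Module" "HOL-Algebra.Generated_Groups" "HOL-Algebra.Free_Abelian_Groups"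
begin

section \<open>Tensor products\<close>

text \<open>
  \<open>M \<otimes>\<^sub>R N\<close> for a right \<open>R\<close>-module \<open>M\<close> with action \<open>r m s\<close> and a left \<open>R\<close>-module \<open>N\<close> with
  action \<open>l s n\<close>: the free abelian group on \<open>M \<times> N\<close> modulo the usual relations. \<open>R\<close> need not be
  commutative, so the result is in general only an abelian group; it is stored in the additive
  part of a ring record, whose multiplicative part is meaningless (as in the library's modules).
\<close>

definition tensor_rels ::
  "('r, 'p) ring_scheme \<Rightarrow> ('m, 'q) ring_scheme \<Rightarrow> ('m \<Rightarrow> 'r \<Rightarrow> 'm) \<Rightarrow>
   ('n, 't) ring_scheme \<Rightarrow> ('r \<Rightarrow> 'n \<Rightarrow> 'n) \<Rightarrow> ('m \<times> 'n \<Rightarrow>\<^sub>0 int) set" where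
  "tensor_rels R M r N l =
     {frag_of (m \<oplus>\<^bsub>M\<^esub> m', n) - frag_of (m, n) - frag_of (m', n) | m m' n.
        m \<in> carrier M \<and> m' \<in> carrier M \<and> n \<in> carrier N} \<union>
     {frag_of (m, n \<oplus>\<^bsub>N\<^esub> n') - frag_of (m, n) - frag_of (m, n') | m n n'.
        m \<in> carrier M \<and> n \<in> carrier N \<and> n' \<in> carrier N} \<union>
     {frag_of (r m s, n) - frag_of (m, l s n) | m s n.
        m \<in> carrier M \<and> s \<in> carrier R \<and> n \<in> carrier N}"

definition tensor_free ::
  "('m, 'q) ring_scheme \<Rightarrow> ('n, 't) ring_scheme \<Rightarrow> ('m \<times> 'n \<Rightarrow>\<^sub>0 int) monoid" where
  "tensor_free M N = free_Abelian_group (carrier M \<times> carrier N)"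

definition tensor_kernel ::
  "('r, 'p) ring_scheme \<Rightarrow> ('m, 'q) ring_scheme \<Rightarrow> ('m \<Rightarrow> 'r \<Rightarrow> 'm) \<Rightarrow>
   ('n, 't) ring_scheme \<Rightarrow> ('r \<Rightarrow> 'n \<Rightarrow> 'n) \<Rightarrow> ('m \<times> 'n \<Rightarrow>\<^sub>0 int) set" where
  "tensor_kernel R M r N l = generate (tensor_free M N) (tensor_rels R M r N l)"

definition tensor ::
  "('r, 'p) ring_scheme \<Rightarrow> ('m, 'q) ring_scheme \<Rightarrow> ('m \<Rightarrow> 'r \<Rightarrow> 'm) \<Rightarrow>
   ('n, 't) ring_scheme \<Rightarrow> ('r \<Rightarrow> 'n \<Rightarrow> 'n) \<Rightarrow> ('m \<times> 'n \<Rightarrow>\<^sub>0 int) set ring" where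
  "tensor R M r N l =
     (let Q = tensor_free M N Mod tensor_kernel R M r N l in
      \<lparr>carrier = carrier Q, monoid.mult = (\<lambda>_ _. undefined), one = undefined,
       ring.zero = \<one>\<^bsub>Q\<^esub>, ring.add = monoid.mult Q\<rparr>)"

definition tens ::
  "('r, 'p) ring_scheme \<Rightarrow> ('m, 'q) ring_scheme \<Rightarrow> ('m \<Rightarrow> 'r \<Rightarrow> 'm) \<Rightarrow>
   ('n, 't) ring_scheme \<Rightarrow> ('r \<Rightarrow> 'n \<Rightarrow> 'n) \<Rightarrow> 'm \<Rightarrow> 'n \<Rightarrow> ('m \<times> 'n \<Rightarrow>\<^sub>0 int) set" where
  "tens R M r N l m n = tensor_kernel R M r N l #>\<^bsub>tensor_free M N\<^esub> frag_of (m, n)"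

text \<open>
  Maps out of a tensor product: \<open>tensor_lift H f\<close> is the map \<open>m \<otimes> n \<mapsto> f m n\<close> into the abelian
  group \<open>H\<close>, computed on a representative \<open>p\<close> of the tensor \<open>X\<close>. The result does not depend on
  \<open>p\<close> when \<open>f\<close> is biadditive and balanced, and the map is used only for such \<open>f\<close>. It serves to
  render Sweedler notation: with \<open>X = \<Delta> c\<close>, \<open>tensor_lift H f X\<close> stands for \<open>f c\<^sub>(\<^sub>1\<^sub>) c\<^sub>(\<^sub>2\<^sub>)\<close>
  (summation understood).
\<close>

definition tensor_lift ::
  "('h, 'p) ring_scheme \<Rightarrow> ('m \<Rightarrow> 'n \<Rightarrow> 'h) \<Rightarrow> ('m \<times> 'n \<Rightarrow>\<^sub>0 int) set \<Rightarrow> 'h" where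
  "tensor_lift H f X =
     (let p = (SOME p. p \<in> X) in
      \<Oplus>\<^bsub>H\<^esub>z \<in> Poly_Mapping.keys p. [Poly_Mapping.lookup p z] \<cdot>\<^bsub>H\<^esub> f (fst z) (snd z))"

subsection \<open>Over a commutative base ring\<close>

definition ktensor ::
  "('k, 'p) ring_scheme \<Rightarrow> ('k, 'm, 'q) module_scheme \<Rightarrow> ('k, 'n, 't) module_scheme \<Rightarrow>
   ('k, ('m \<times> 'n \<Rightarrow>\<^sub>0 int) set) module" where
  "ktensor k M N =
     (let T = tensor k M (\<lambda>m s. s \<odot>\<^bsub>M\<^esub> m) N (\<lambda>s n. s \<odot>\<^bsub>N\<^esub> n) in
      ring.extend T
        \<lparr>smult = (\<lambda>s. tensor_lift T
           (\<lambda>m n. tens k M (\<lambda>m s. s \<odot>\<^bsub>M\<^esub> m) N (\<lambda>s n. s \<odot>\<^bsub>N\<^esub> n) (s \<odot>\<^bsub>M\<^esub> m) n))\<rparr>)"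

definition ktens ::
  "('k, 'p) ring_scheme \<Rightarrow> ('k, 'm, 'q) module_scheme \<Rightarrow> ('k, 'n, 't) module_scheme \<Rightarrow>
   'm \<Rightarrow> 'n \<Rightarrow> ('m \<times> 'n \<Rightarrow>\<^sub>0 int) set" where
  "ktens k M N = tens k M (\<lambda>m s. s \<odot>\<^bsub>M\<^esub> m) N (\<lambda>s n. s \<odot>\<^bsub>N\<^esub> n)"

subsection \<open>\<open>A \<otimes>\<^sub>B A\<close> for a ring homomorphism \<open>j: B \<rightarrow> A\<close>\<close>

definition ext_tensor ::
  "('b, 'p) ring_scheme \<Rightarrow> ('a, 'q) ring_scheme \<Rightarrow> ('b \<Rightarrow> 'a) \<Rightarrow> ('a \<times> 'a \<Rightarrow>\<^sub>0 int) set ring" where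
  "ext_tensor B A j = tensor B A (\<lambda>a b. a \<otimes>\<^bsub>A\<^esub> j b) A (\<lambda>b a. j b \<otimes>\<^bsub>A\<^esub> a)"

definition ext_tens ::
  "('b, 'p) ring_scheme \<Rightarrow> ('a, 'q) ring_scheme \<Rightarrow> ('b \<Rightarrow> 'a) \<Rightarrow> 'a \<Rightarrow> 'a \<Rightarrow>
   ('a \<times> 'a \<Rightarrow>\<^sub>0 int) set" where
  "ext_tens B A j = tens B A (\<lambda>a b. a \<otimes>\<^bsub>A\<^esub> j b) A (\<lambda>b a. j b \<otimes>\<^bsub>A\<^esub> a)"

section \<open>Algebras, coalgebras, comodules\<close>

text \<open>The library's \<open>algebra\<close> is commutative.\<close>

locale k_algebra = module + ring M +
  assumes smult_mult_left:
      "\<lbrakk>s \<in> carrier R; x \<in> carrier M; y \<in> carrier M\<rbrakk> \<Longrightarrow>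
       (s \<odot>\<^bsub>M\<^esub> x) \<otimes>\<^bsub>M\<^esub> y = s \<odot>\<^bsub>M\<^esub> (x \<otimes>\<^bsub>M\<^esub> y)"
    and smult_mult_right:
      "\<lbrakk>s \<in> carrier R; x \<in> carrier M; y \<in> carrier M\<rbrakk> \<Longrightarrow>
       x \<otimes>\<^bsub>M\<^esub> (s \<odot>\<^bsub>M\<^esub> y) = s \<odot>\<^bsub>M\<^esub> (x \<otimes>\<^bsub>M\<^esub> y)"

definition k_linear ::
  "('k, 'p) ring_scheme \<Rightarrow> ('k, 'm, 'q) module_scheme \<Rightarrow> ('k, 'n, 't) module_scheme \<Rightarrow>
   ('m \<Rightarrow> 'n) \<Rightarrow> bool" where
  "k_linear k M N f \<longleftrightarrow>
     f \<in> hom (add_monoid M) (add_monoid N) \<and>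
     (\<forall>s \<in> carrier k. \<forall>x \<in> carrier M. f (s \<odot>\<^bsub>M\<^esub> x) = s \<odot>\<^bsub>N\<^esub> f x)"

definition k_algebra_hom ::
  "('k, 'p) ring_scheme \<Rightarrow> ('k, 'b, 'q) module_scheme \<Rightarrow> ('k, 'a, 't) module_scheme \<Rightarrow>
   ('b \<Rightarrow> 'a) \<Rightarrow> bool" where
  "k_algebra_hom k B A f \<longleftrightarrow> f \<in> ring_hom B A \<and> k_linear k B A f"

record ('k, 'c) coalgebra = "('k, 'c) module" +
  comult :: "'c \<Rightarrow> ('c \<times> 'c \<Rightarrow>\<^sub>0 int) set"
  counit :: "'c \<Rightarrow> 'k"

text \<open>Triple tensor products are bracketed to the right.\<close>

locale coalgebra = module k C
  for k :: "('k, 'p) ring_scheme" and C :: "('k, 'c, 'q) coalgebra_scheme" +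
  assumes comult_linear: "k_linear k C (ktensor k C C) (comult C)"
    and counit_add: "counit C \<in> hom (add_monoid C) (add_monoid k)"
    and counit_smult: "\<lbrakk>s \<in> carrier k; c \<in> carrier C\<rbrakk> \<Longrightarrow>
          counit C (s \<odot>\<^bsub>C\<^esub> c) = s \<otimes>\<^bsub>k\<^esub> counit C c"
    and coassoc: "c \<in> carrier C \<Longrightarrow>
          tensor_lift (ktensor k C (ktensor k C C))
            (\<lambda>c1 c2. tensor_lift (ktensor k C (ktensor k C C))
               (\<lambda>c11 c12. ktens k C (ktensor k C C) c11 (ktens k C C c12 c2))
               (comult C c1))
            (comult C c) =
          tensor_lift (ktensor k C (ktensor k C C))
            (\<lambda>c1 c2. ktens k C (ktensor k C C) c1 (comult C c2))
            (comult C c)"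
    and counit_left: "c \<in> carrier C \<Longrightarrow>
          tensor_lift C (\<lambda>c1 c2. counit C c1 \<odot>\<^bsub>C\<^esub> c2) (comult C c) = c"
    and counit_right: "c \<in> carrier C \<Longrightarrow>
          tensor_lift C (\<lambda>c1 c2. counit C c2 \<odot>\<^bsub>C\<^esub> c1) (comult C c) = c"

locale right_comodule = coalgebra k C + M: module k M
  for k :: "('k, 'p) ring_scheme" and C :: "('k, 'c, 'q) coalgebra_scheme"
    and M :: "('k, 'm, 't) module_scheme" and \<rho> :: "'m \<Rightarrow> ('m \<times> 'c \<Rightarrow>\<^sub>0 int) set" +
  assumes coaction_linear: "k_linear k M (ktensor k M C) \<rho>"
    and coaction_coassoc: "m \<in> carrier M \<Longrightarrow>
          tensor_lift (ktensor k M (ktensor k C C))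
            (\<lambda>m0 c. tensor_lift (ktensor k M (ktensor k C C))
               (\<lambda>m00 c'. ktens k M (ktensor k C C) m00 (ktens k C C c' c))
               (\<rho> m0))
            (\<rho> m) =
          tensor_lift (ktensor k M (ktensor k C C))
            (\<lambda>m0 c. ktens k M (ktensor k C C) m0 (comult C c))
            (\<rho> m)"
    and coaction_counit: "m \<in> carrier M \<Longrightarrow>
          tensor_lift M (\<lambda>m0 c. counit C c \<odot>\<^bsub>M\<^esub> m0) (\<rho> m) = m"

section \<open>\<open>C\<close>-Galois extensions\<close>

text \<open>The left \<open>A\<close>-action \<open>a (b \<otimes> c) = a b \<otimes> c\<close> on \<open>A \<otimes>\<^sub>k C\<close>.\<close>

definition left_mult_tensor ::
  "('k, 'p) ring_scheme \<Rightarrow> ('k, 'a, 'q) module_scheme \<Rightarrow> ('k, 'c, 't) module_scheme \<Rightarrow>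
   'a \<Rightarrow> ('a \<times> 'c \<Rightarrow>\<^sub>0 int) set \<Rightarrow> ('a \<times> 'c \<Rightarrow>\<^sub>0 int) set" where
  "left_mult_tensor k A C a =
     tensor_lift (ktensor k A C) (\<lambda>b c. ktens k A C (a \<otimes>\<^bsub>A\<^esub> b) c)"

text \<open>
  That \<open>can\<close> is well defined is part of the definition: an additive map with the prescribed
  values on the generators \<open>a \<otimes>\<^sub>B a'\<close>, necessarily unique, is required to exist. Such a map is
  automatically left \<open>A\<close>-linear. \<open>i\<close> is not assumed to be injective, and \<open>B\<close> viewed in \<open>A\<close> is
  its image under \<open>i\<close>.
\<close>

definition galois_extension ::
  "('k, 'p) ring_scheme \<Rightarrow> ('k, 'c, 'q) coalgebra_scheme \<Rightarrow> ('k, 'b, 's) module_scheme \<Rightarrow>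
   ('k, 'a, 't) module_scheme \<Rightarrow> ('b \<Rightarrow> 'a) \<Rightarrow> bool" where
  "galois_extension k C B A i \<longleftrightarrow>
     (\<exists>\<rho>. right_comodule k C A \<rho> \<and>
        (\<exists>can \<in> iso (add_monoid (ext_tensor B A i)) (add_monoid (ktensor k A C)).
           \<forall>a \<in> carrier A. \<forall>a' \<in> carrier A.
             can (ext_tens B A i a a') = left_mult_tensor k A C a (\<rho> a')) \<and>
        i ` carrier B = {a \<in> carrier A. \<rho> a = left_mult_tensor k A C a (\<rho> \<one>\<^bsub>A\<^esub>)})"

section \<open>Corings\<close>

record ('a, 'x) coring = "('a, 'x) module" +
  rsmult :: "'x \<Rightarrow> 'a \<Rightarrow> 'x"
  cor_comult :: "'x \<Rightarrow> ('x \<times> 'x \<Rightarrow>\<^sub>0 int) set"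
  cor_counit :: "'x \<Rightarrow> 'a"

definition coring_tensor ::
  "('a, 'p) ring_scheme \<Rightarrow> ('a, 'x, 'q) coring_scheme \<Rightarrow> ('a, ('x \<times> 'x \<Rightarrow>\<^sub>0 int) set) module" where
  "coring_tensor A X =
     (let T = tensor A X (rsmult X) X (smult X) in
      ring.extend T
        \<lparr>smult = (\<lambda>a. tensor_lift T
           (\<lambda>x y. tens A X (rsmult X) X (smult X) (a \<odot>\<^bsub>X\<^esub> x) y))\<rparr>)"

definition coring_tens ::
  "('a, 'p) ring_scheme \<Rightarrow> ('a, 'x, 'q) coring_scheme \<Rightarrow> 'x \<Rightarrow> 'x \<Rightarrow> ('x \<times> 'x \<Rightarrow>\<^sub>0 int) set" where
  "coring_tens A X = tens A X (rsmult X) X (smult X)"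

definition coring_tensor_rsmult ::
  "('a, 'p) ring_scheme \<Rightarrow> ('a, 'x, 'q) coring_scheme \<Rightarrow>
   ('x \<times> 'x \<Rightarrow>\<^sub>0 int) set \<Rightarrow> 'a \<Rightarrow> ('x \<times> 'x \<Rightarrow>\<^sub>0 int) set" where
  "coring_tensor_rsmult A X t a =
     tensor_lift (coring_tensor A X) (\<lambda>x y. coring_tens A X x (rsmult X y a)) t"

text \<open>\<open>X \<otimes>\<^sub>A (X \<otimes>\<^sub>A X)\<close>\<close>

definition coring_tensor3 ::
  "('a, 'p) ring_scheme \<Rightarrow> ('a, 'x, 'q) coring_scheme \<Rightarrow>
   ('x \<times> ('x \<times> 'x \<Rightarrow>\<^sub>0 int) set \<Rightarrow>\<^sub>0 int) set ring" where
  "coring_tensor3 A X =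
     tensor A X (rsmult X) (coring_tensor A X) (smult (coring_tensor A X))"

definition coring_tens3 ::
  "('a, 'p) ring_scheme \<Rightarrow> ('a, 'x, 'q) coring_scheme \<Rightarrow>
   'x \<Rightarrow> ('x \<times> 'x \<Rightarrow>\<^sub>0 int) set \<Rightarrow> ('x \<times> ('x \<times> 'x \<Rightarrow>\<^sub>0 int) set \<Rightarrow>\<^sub>0 int) set" where
  "coring_tens3 A X =
     tens A X (rsmult X) (coring_tensor A X) (smult (coring_tensor A X))"

locale coring = A: ring A + X: abelian_group X
  for A :: "('a, 'p) ring_scheme" and X :: "('a, 'x, 'q) coring_scheme" +
  assumes lsmult_closed: "\<lbrakk>a \<in> carrier A; x \<in> carrier X\<rbrakk> \<Longrightarrow> a \<odot>\<^bsub>X\<^esub> x \<in> carrier X"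
    and lsmult_l_distr: "\<lbrakk>a \<in> carrier A; b \<in> carrier A; x \<in> carrier X\<rbrakk> \<Longrightarrow>
          (a \<oplus>\<^bsub>A\<^esub> b) \<odot>\<^bsub>X\<^esub> x = a \<odot>\<^bsub>X\<^esub> x \<oplus>\<^bsub>X\<^esub> b \<odot>\<^bsub>X\<^esub> x"
    and lsmult_r_distr: "\<lbrakk>a \<in> carrier A; x \<in> carrier X; y \<in> carrier X\<rbrakk> \<Longrightarrow>
          a \<odot>\<^bsub>X\<^esub> (x \<oplus>\<^bsub>X\<^esub> y) = a \<odot>\<^bsub>X\<^esub> x \<oplus>\<^bsub>X\<^esub> a \<odot>\<^bsub>X\<^esub> y"
    and lsmult_assoc: "\<lbrakk>a \<in> carrier A; b \<in> carrier A; x \<in> carrier X\<rbrakk> \<Longrightarrow>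
          (a \<otimes>\<^bsub>A\<^esub> b) \<odot>\<^bsub>X\<^esub> x = a \<odot>\<^bsub>X\<^esub> (b \<odot>\<^bsub>X\<^esub> x)"
    and lsmult_one: "x \<in> carrier X \<Longrightarrow> \<one>\<^bsub>A\<^esub> \<odot>\<^bsub>X\<^esub> x = x"
    and rsmult_closed: "\<lbrakk>a \<in> carrier A; x \<in> carrier X\<rbrakk> \<Longrightarrow> rsmult X x a \<in> carrier X"
    and rsmult_r_distr: "\<lbrakk>a \<in> carrier A; b \<in> carrier A; x \<in> carrier X\<rbrakk> \<Longrightarrow>
          rsmult X x (a \<oplus>\<^bsub>A\<^esub> b) = rsmult X x a \<oplus>\<^bsub>X\<^esub> rsmult X x b"
    and rsmult_l_distr: "\<lbrakk>a \<in> carrier A; x \<in> carrier X; y \<in> carrier X\<rbrakk> \<Longrightarrow>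
          rsmult X (x \<oplus>\<^bsub>X\<^esub> y) a = rsmult X x a \<oplus>\<^bsub>X\<^esub> rsmult X y a"
    and rsmult_assoc: "\<lbrakk>a \<in> carrier A; b \<in> carrier A; x \<in> carrier X\<rbrakk> \<Longrightarrow>
          rsmult X x (a \<otimes>\<^bsub>A\<^esub> b) = rsmult X (rsmult X x a) b"
    and rsmult_one: "x \<in> carrier X \<Longrightarrow> rsmult X x \<one>\<^bsub>A\<^esub> = x"
    and bimodule: "\<lbrakk>a \<in> carrier A; b \<in> carrier A; x \<in> carrier X\<rbrakk> \<Longrightarrow>
          rsmult X (a \<odot>\<^bsub>X\<^esub> x) b = a \<odot>\<^bsub>X\<^esub> rsmult X x b"
    and cor_comult_add:
          "cor_comult X \<in> hom (add_monoid X) (add_monoid (coring_tensor A X))"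
    and cor_comult_left: "\<lbrakk>a \<in> carrier A; x \<in> carrier X\<rbrakk> \<Longrightarrow>
          cor_comult X (a \<odot>\<^bsub>X\<^esub> x) = a \<odot>\<^bsub>coring_tensor A X\<^esub> cor_comult X x"
    and cor_comult_right: "\<lbrakk>a \<in> carrier A; x \<in> carrier X\<rbrakk> \<Longrightarrow>
          cor_comult X (rsmult X x a) = coring_tensor_rsmult A X (cor_comult X x) a"
    and cor_counit_add: "cor_counit X \<in> hom (add_monoid X) (add_monoid A)"
    and cor_counit_left: "\<lbrakk>a \<in> carrier A; x \<in> carrier X\<rbrakk> \<Longrightarrow>
          cor_counit X (a \<odot>\<^bsub>X\<^esub> x) = a \<otimes>\<^bsub>A\<^esub> cor_counit X x"
    and cor_counit_right: "\<lbrakk>a \<in> carrier A; x \<in> carrier X\<rbrakk> \<Longrightarrow>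
          cor_counit X (rsmult X x a) = cor_counit X x \<otimes>\<^bsub>A\<^esub> a"
    and cor_coassoc: "x \<in> carrier X \<Longrightarrow>
          tensor_lift (coring_tensor3 A X)
            (\<lambda>x1 x2. tensor_lift (coring_tensor3 A X)
               (\<lambda>x11 x12. coring_tens3 A X x11 (coring_tens A X x12 x2))
               (cor_comult X x1))
            (cor_comult X x) =
          tensor_lift (coring_tensor3 A X)
            (\<lambda>x1 x2. coring_tens3 A X x1 (cor_comult X x2))
            (cor_comult X x)"
    and counit_comult_left: "x \<in> carrier X \<Longrightarrow>
          tensor_lift X (\<lambda>x1 x2. cor_counit X x1 \<odot>\<^bsub>X\<^esub> x2) (cor_comult X x) = x"
    and counit_comult_right: "x \<in> carrier X \<Longrightarrow>
          tensor_lift X (\<lambda>x1 x2. rsmult X x1 (cor_counit X x2)) (cor_comult X x) = x"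

definition grouplike :: "('a, 'p) ring_scheme \<Rightarrow> ('a, 'x, 'q) coring_scheme \<Rightarrow> 'x \<Rightarrow> bool" where
  "grouplike A X x \<longleftrightarrow>
     x \<in> carrier X \<and> cor_comult X x = coring_tens A X x x \<and> cor_counit X x = \<one>\<^bsub>A\<^esub>"

definition coinvariants :: "('a, 'p) ring_scheme \<Rightarrow> ('a, 'x, 'q) coring_scheme \<Rightarrow> 'x \<Rightarrow> 'a set" where
  "coinvariants A X x = {b \<in> carrier A. b \<odot>\<^bsub>X\<^esub> x = rsmult X x b}"

definition galois_coring :: "('a, 'p) ring_scheme \<Rightarrow> ('a, 'x, 'q) coring_scheme \<Rightarrow> 'x \<Rightarrow> bool" where
  "galois_coring A X x \<longleftrightarrow>
     coring A X \<and> grouplike A X x \<and>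
     (let B = A\<lparr>carrier := coinvariants A X x\<rparr> in
      \<exists>can \<in> iso (add_monoid (ext_tensor B A (\<lambda>b. b))) (add_monoid X).
        \<forall>a \<in> carrier A. \<forall>a' \<in> carrier A.
          can (ext_tens B A (\<lambda>b. b) a a') = rsmult X (a \<odot>\<^bsub>X\<^esub> x) a')"

section \<open>Entwining structures\<close>

text \<open>
  In \<open>entwining_comult\<close> the left-hand side is \<open>a\<^sub>\<psi> \<otimes> \<Delta>(c\<^sup>\<psi>)\<close>; on the right \<open>\<psi>\<close> is applied first to
  \<open>c\<^sub>(\<^sub>2\<^sub>) \<otimes> a\<close>, giving \<open>a' \<otimes> c2'\<close>, and then to \<open>c\<^sub>(\<^sub>1\<^sub>) \<otimes> a'\<close>.
\<close>

locale entwining_structure = k_algebra k A + coalgebra k C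
  for k :: "('k, 'p) ring_scheme" and A :: "('k, 'a, 'q) module_scheme"
    and C :: "('k, 'c, 't) coalgebra_scheme"
    and \<psi> :: "('c \<times> 'a \<Rightarrow>\<^sub>0 int) set \<Rightarrow> ('a \<times> 'c \<Rightarrow>\<^sub>0 int) set" +
  assumes entwining_linear: "k_linear k (ktensor k C A) (ktensor k A C) \<psi>"
    and entwining_mult: "\<lbrakk>a \<in> carrier A; b \<in> carrier A; c \<in> carrier C\<rbrakk> \<Longrightarrow>
          \<psi> (ktens k C A c (a \<otimes>\<^bsub>A\<^esub> b)) =
          tensor_lift (ktensor k A C)
            (\<lambda>a' c'. tensor_lift (ktensor k A C)
               (\<lambda>b' c''. ktens k A C (a' \<otimes>\<^bsub>A\<^esub> b') c'')
               (\<psi> (ktens k C A c' b)))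
            (\<psi> (ktens k C A c a))"
    and entwining_one: "c \<in> carrier C \<Longrightarrow> \<psi> (ktens k C A c \<one>\<^bsub>A\<^esub>) = ktens k A C \<one>\<^bsub>A\<^esub> c"
    and entwining_comult: "\<lbrakk>a \<in> carrier A; c \<in> carrier C\<rbrakk> \<Longrightarrow>
          tensor_lift (ktensor k A (ktensor k C C))
            (\<lambda>a' c'. ktens k A (ktensor k C C) a' (comult C c'))
            (\<psi> (ktens k C A c a)) =
          tensor_lift (ktensor k A (ktensor k C C))
            (\<lambda>c1 c2. tensor_lift (ktensor k A (ktensor k C C))
               (\<lambda>a' c2'. tensor_lift (ktensor k A (ktensor k C C))
                  (\<lambda>a'' c1'. ktens k A (ktensor k C C) a'' (ktens k C C c1' c2'))
                  (\<psi> (ktens k C A c1 a')))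
               (\<psi> (ktens k C A c2 a)))
            (comult C c)"
    and entwining_counit: "\<lbrakk>a \<in> carrier A; c \<in> carrier C\<rbrakk> \<Longrightarrow>
          tensor_lift A (\<lambda>a' c'. counit C c' \<odot>\<^bsub>A\<^esub> a') (\<psi> (ktens k C A c a)) =
          counit C c \<odot>\<^bsub>A\<^esub> a"

subsection \<open>The associated coring\<close>

definition entwining_bimodule ::
  "('k, 'p) ring_scheme \<Rightarrow> ('k, 'a, 'q) module_scheme \<Rightarrow> ('k, 'c, 't) coalgebra_scheme \<Rightarrow>
   (('c \<times> 'a \<Rightarrow>\<^sub>0 int) set \<Rightarrow> ('a \<times> 'c \<Rightarrow>\<^sub>0 int) set) \<Rightarrow>
   ('a, ('a \<times> 'c \<Rightarrow>\<^sub>0 int) set) coring" where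
  "entwining_bimodule k A C \<psi> =
     \<lparr>carrier = carrier (ktensor k A C), monoid.mult = (\<lambda>_ _. undefined), one = undefined,
      ring.zero = \<zero>\<^bsub>ktensor k A C\<^esub>, ring.add = ring.add (ktensor k A C),
      smult = left_mult_tensor k A C,
      rsmult = (\<lambda>x a. tensor_lift (ktensor k A C)
        (\<lambda>b c. left_mult_tensor k A C b (\<psi> (ktens k C A c a))) x),
      cor_comult = undefined,
      cor_counit = undefined\<rparr>"

text \<open>
  The identification \<open>(A \<otimes> C) \<otimes>\<^sub>A (A \<otimes> C) \<cong> A \<otimes> C \<otimes> C\<close> sends \<open>(a \<otimes> c) \<otimes>\<^sub>A (1 \<otimes> c')\<close> to
  \<open>a \<otimes> c \<otimes> c'\<close>, so \<open>I\<^sub>A \<otimes> \<Delta>\<close> becomes \<open>a \<otimes> c \<mapsto> (a \<otimes> c\<^sub>(\<^sub>1\<^sub>)) \<otimes>\<^sub>A (1 \<otimes> c\<^sub>(\<^sub>2\<^sub>))\<close>. The tensor product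
  over \<open>A\<close> depends only on the bimodule part of the record, whence the definition in two steps.
\<close>

definition entwining_coring ::
  "('k, 'p) ring_scheme \<Rightarrow> ('k, 'a, 'q) module_scheme \<Rightarrow> ('k, 'c, 't) coalgebra_scheme \<Rightarrow>
   (('c \<times> 'a \<Rightarrow>\<^sub>0 int) set \<Rightarrow> ('a \<times> 'c \<Rightarrow>\<^sub>0 int) set) \<Rightarrow>
   ('a, ('a \<times> 'c \<Rightarrow>\<^sub>0 int) set) coring" where
  "entwining_coring k A C \<psi> =
     (let X = entwining_bimodule k A C \<psi> in
      X\<lparr>cor_comult :=
          tensor_lift (coring_tensor A X)
            (\<lambda>a c. tensor_lift (coring_tensor A X)
               (\<lambda>c1 c2. coring_tens A X (ktens k A C a c1) (ktens k A C \<one>\<^bsub>A\<^esub> c2))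
               (comult C c)),
        cor_counit := tensor_lift A (\<lambda>a c. counit C c \<odot>\<^bsub>A\<^esub> a)\<rparr>)"

end

theory Submission
  imports Defs
begin

text \<open>
  Given an entwining map and a grouplike \<open>x\<close>, the coaction is \<open>\<rho> a = x a\<close>. Coassociativity of \<open>\<rho>\<close> is
  the image of \<open>\<Delta> (x a) = \<Delta> x a = x \<otimes>\<^sub>A x a\<close> under \<open>(A \<otimes> C) \<otimes>\<^sub>A (A \<otimes> C) \<rightarrow> A \<otimes> C \<otimes> C\<close>, and the two
  canonical maps agree. Conversely, the right \<open>A\<close>-module structure of \<open>A \<otimes>\<^sub>B A\<close> is transported along
  the bijection \<open>can\<close> to \<open>A \<otimes> C\<close>, and \<open>\<psi> (c \<otimes> a) = (1 \<otimes> c) a\<close>. With \<open>x = \<rho> 1\<close>, the elements \<open>b x a\<close>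
  generate \<open>A \<otimes> C\<close> additively and \<open>\<Delta> (b x a) = b x \<otimes>\<^sub>A x a\<close>, \<open>\<epsilon> (b x a) = b a\<close>: this is Sweedler's
  coring, for which the coring axioms are evident, and the remaining entwining axioms say
  that \<open>\<Delta>\<close> and \<open>\<epsilon>\<close> are right \<open>A\<close>-linear.
\<close>

section \<open>Maps out of a tensor product\<close>

text \<open>A Sweedler expression is here a \<open>tensor_lift\<close> evaluated on an arbitrarily
  chosen representative, so nothing can be computed with it until the lifted function is known to be
  balanced. This fixes the pattern of the whole development: each construction gets a balancedness
  lemma, then additivity and its value on generators, and an identity is an equality of two additive
  maps compared on generators.

  The choice of \<psi> is forced. A right action on A \<otimes> C that commutes with the given left
  action satisfies (b \<otimes> c) a = b ((1 \<otimes> c) a), so it is determined by the elements (1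
  \<otimes> c) a. The transported action has no direct formula on pure tensors, which is why the
  converse computes on the other generating family.

  A second difficulty is that the axioms live in different places: coassociativity of \<rho> and the
  entwining axiom for \<Delta> in A \<otimes> (C \<otimes> C), those of a coring in a tensor square
  over A. The maps \<open>eta\<close> and \<open>theta\<close> translate between the two. Since a
  Galois coring is in particular a coring, one direction may use right linearity of \<Delta> and
  \<epsilon>, and the other has to establish it.\<close>

definition add_hom :: "('m, 'p) ring_scheme \<Rightarrow> ('n, 'q) ring_scheme \<Rightarrow> ('m \<Rightarrow> 'n) \<Rightarrow> bool" where
  "add_hom M N f \<longleftrightarrow> (\<forall>x \<in> carrier M. f x \<in> carrier N) \<and>
     (\<forall>x \<in> carrier M. \<forall>y \<in> carrier M. f (x \<oplus>\<^bsub>M\<^esub> y) = f x \<oplus>\<^bsub>N\<^esub> f y)"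

lemma add_hom_iff_hom: "add_hom M N f \<longleftrightarrow> f \<in> hom (add_monoid M) (add_monoid N)"
  by (auto simp: add_hom_def hom_def)

lemma add_homI:
  assumes "\<And>x. x \<in> carrier M \<Longrightarrow> f x \<in> carrier N"
    and "\<And>x y. \<lbrakk>x \<in> carrier M; y \<in> carrier M\<rbrakk> \<Longrightarrow> f (x \<oplus>\<^bsub>M\<^esub> y) = f x \<oplus>\<^bsub>N\<^esub> f y"
  shows "add_hom M N f"
  using assms by (simp add: add_hom_def)

lemma add_hom_closed: "\<lbrakk>add_hom M N f; x \<in> carrier M\<rbrakk> \<Longrightarrow> f x \<in> carrier N"
  by (simp add: add_hom_def)

lemma add_hom_add:
  "\<lbrakk>add_hom M N f; x \<in> carrier M; y \<in> carrier M\<rbrakk> \<Longrightarrow> f (x \<oplus>\<^bsub>M\<^esub> y) = f x \<oplus>\<^bsub>N\<^esub> f y"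
  by (simp add: add_hom_def)

lemma add_hom_ident: "add_hom M M (\<lambda>x. x)"
  by (simp add: add_hom_def)

lemma add_hom_comp:
  "\<lbrakk>add_hom M N f; add_hom N P g\<rbrakk> \<Longrightarrow> add_hom M P (\<lambda>x. g (f x))"
  by (simp add: add_hom_def)

lemma add_hom_group_hom:
  assumes "abelian_group M" "abelian_group N" "add_hom M N f"
  shows "group_hom (add_monoid M) (add_monoid N) f"
  using assms by (auto simp: group_hom_def group_hom_axioms_def add_hom_iff_hom abelian_group.a_group)

definition biadd ::
  "('m, 'p) ring_scheme \<Rightarrow> ('n, 'q) ring_scheme \<Rightarrow> ('h, 's) ring_scheme \<Rightarrow>
   ('m \<Rightarrow> 'n \<Rightarrow> 'h) \<Rightarrow> bool" where
  "biadd M N H f \<longleftrightarrow>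
     (\<forall>m \<in> carrier M. add_hom N H (f m)) \<and> (\<forall>n \<in> carrier N. add_hom M H (\<lambda>m. f m n))"

definition balanced ::
  "('r, 'p) ring_scheme \<Rightarrow> ('m, 'q) ring_scheme \<Rightarrow> ('m \<Rightarrow> 'r \<Rightarrow> 'm) \<Rightarrow>
   ('n, 't) ring_scheme \<Rightarrow> ('r \<Rightarrow> 'n \<Rightarrow> 'n) \<Rightarrow> ('h, 's) ring_scheme \<Rightarrow>
   ('m \<Rightarrow> 'n \<Rightarrow> 'h) \<Rightarrow> bool" where
  "balanced R M r N l H f \<longleftrightarrow> biadd M N H f \<and>
     (\<forall>m \<in> carrier M. \<forall>s \<in> carrier R. \<forall>n \<in> carrier N. f (r m s) n = f m (l s n))"

lemma biaddI:
  assumes "\<And>m n. \<lbrakk>m \<in> carrier M; n \<in> carrier N\<rbrakk> \<Longrightarrow> f m n \<in> carrier H"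
    and "\<And>m m' n. \<lbrakk>m \<in> carrier M; m' \<in> carrier M; n \<in> carrier N\<rbrakk> \<Longrightarrow>
           f (m \<oplus>\<^bsub>M\<^esub> m') n = f m n \<oplus>\<^bsub>H\<^esub> f m' n"
    and "\<And>m n n'. \<lbrakk>m \<in> carrier M; n \<in> carrier N; n' \<in> carrier N\<rbrakk> \<Longrightarrow>
           f m (n \<oplus>\<^bsub>N\<^esub> n') = f m n \<oplus>\<^bsub>H\<^esub> f m n'"
  shows "biadd M N H f"
  using assms by (simp add: biadd_def add_hom_def)

lemma biadd_closed:
  "\<lbrakk>biadd M N H f; m \<in> carrier M; n \<in> carrier N\<rbrakk> \<Longrightarrow> f m n \<in> carrier H"
  by (simp add: biadd_def add_hom_def)

lemma biadd_right: "\<lbrakk>biadd M N H f; m \<in> carrier M\<rbrakk> \<Longrightarrow> add_hom N H (f m)"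
  by (simp add: biadd_def)

lemma biadd_left: "\<lbrakk>biadd M N H f; n \<in> carrier N\<rbrakk> \<Longrightarrow> add_hom M H (\<lambda>m. f m n)"
  by (simp add: biadd_def)

lemma biadd_flip: "biadd N M H (\<lambda>n m. f m n)" if "biadd M N H f"
  using that by (auto simp: biadd_def)

lemma biadd_comp:
  assumes "biadd M N H f" "add_hom M' M g" "add_hom N' N h"
  shows "biadd M' N' H (\<lambda>m n. f (g m) (h n))"
  using assms by (simp add: biadd_def add_hom_def)

lemma biadd_post:
  assumes "biadd M N H f" "add_hom H K g"
  shows "biadd M N K (\<lambda>m n. g (f m n))"
  using assms by (simp add: biadd_def add_hom_def)

lemma balancedI:
  assumes "biadd M N H f"
    and "\<And>m s n. \<lbrakk>m \<in> carrier M; s \<in> carrier R; n \<in> carrier N\<rbrakk> \<Longrightarrow> f (r m s) n = f m (l s n)"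
  shows "balanced R M r N l H f"
  using assms by (simp add: balanced_def)

lemma balanced_biadd: "balanced R M r N l H f \<Longrightarrow> biadd M N H f"
  by (simp add: balanced_def)

section \<open>Formal integer combinations evaluated in an abelian group\<close>

definition frag_eval :: "('h, 'p) ring_scheme \<Rightarrow> ('z \<Rightarrow> 'h) \<Rightarrow> ('z \<Rightarrow>\<^sub>0 int) \<Rightarrow> 'h" where
  "frag_eval H f p = (\<Oplus>\<^bsub>H\<^esub>z \<in> Poly_Mapping.keys p. [Poly_Mapping.lookup p z] \<cdot>\<^bsub>H\<^esub> f z)"

lemma tensor_lift_frag_eval:
  "tensor_lift H f X = frag_eval H (\<lambda>z. f (fst z) (snd z)) (SOME p. p \<in> X)"
  by (simp add: tensor_lift_def frag_eval_def Let_def)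

context abelian_group
begin

text \<open>Cancellation can make the support of p + q smaller than the union of the supports.
  Padding with zero coefficients puts all sums over one common finite set.\<close>

lemma frag_eval_superset:
  assumes "f ` K \<subseteq> carrier G" "finite K" "Poly_Mapping.keys p \<subseteq> K"
  shows "frag_eval G f p = (\<Oplus>\<^bsub>G\<^esub>z \<in> K. [Poly_Mapping.lookup p z] \<cdot>\<^bsub>G\<^esub> f z)"
  unfolding frag_eval_def
proof (rule add.finprod_mono_neutral_cong_left)
  show "\<And>i. i \<in> K - Poly_Mapping.keys p \<Longrightarrow> [poly_mapping.lookup p i] \<cdot> f i = \<zero>"
    using assms by (auto simp: in_keys_iff add_pow_def)
qed (use assms in \<open>auto intro!: add.int_pow_closed\<close>)

lemma frag_eval_closed:
  assumes "f ` S \<subseteq> carrier G" "Poly_Mapping.keys p \<subseteq> S"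
  shows "frag_eval G f p \<in> carrier G"
  unfolding frag_eval_def using assms by (auto intro!: finsum_closed add.int_pow_closed)

lemma frag_eval_add:
  assumes f: "f ` S \<subseteq> carrier G" and p: "Poly_Mapping.keys p \<subseteq> S" and q: "Poly_Mapping.keys q \<subseteq> S"
  shows "frag_eval G f (p + q) = frag_eval G f p \<oplus> frag_eval G f q"
proof -
  let ?K = "Poly_Mapping.keys p \<union> Poly_Mapping.keys q"
  have K: "f ` ?K \<subseteq> carrier G" "finite ?K"
    using assms by auto
  have "frag_eval G f (p + q)
      = (\<Oplus>z\<in>?K. [Poly_Mapping.lookup p z] \<cdot> f z \<oplus> [Poly_Mapping.lookup q z] \<cdot> f z)"
    using K Poly_Mapping.keys_add[of p q]
    by (subst frag_eval_superset[OF K])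
       (auto simp: lookup_add add.int_pow_mult intro!: finsum_cong' add.int_pow_closed)
  also have "\<dots> = frag_eval G f p \<oplus> frag_eval G f q"
    using K by (subst finsum_addf)
       (auto simp: frag_eval_superset[OF K] intro!: add.int_pow_closed)
  finally show ?thesis .
qed

lemma frag_eval_hom:
  assumes "f ` S \<subseteq> carrier G"
  shows "group_hom (free_Abelian_group S) (add_monoid G) (frag_eval G f)"
  by (auto simp: group_hom_def group_hom_axioms_def hom_def a_group
      frag_eval_closed[OF assms] frag_eval_add[OF assms])

lemma frag_eval_of:
  assumes "f z \<in> carrier G"
  shows "frag_eval G f (frag_of z) = f z"
  using assms by (simp add: frag_eval_def keys_frag_of add.int_pow_1 finsum_singleton)

end

section \<open>The universal property of the tensor product\<close>

locale tensor_product =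
  fixes R :: "('r, 'p) ring_scheme" and M :: "('m, 'q) ring_scheme" and r :: "'m \<Rightarrow> 'r \<Rightarrow> 'm"
    and N :: "('n, 't) ring_scheme" and l :: "'r \<Rightarrow> 'n \<Rightarrow> 'n"
  assumes left_abelian_group: "abelian_group M"
    and right_abelian_group: "abelian_group N"
    and r_closed: "\<lbrakk>m \<in> carrier M; s \<in> carrier R\<rbrakk> \<Longrightarrow> r m s \<in> carrier M"
    and l_closed: "\<lbrakk>s \<in> carrier R; n \<in> carrier N\<rbrakk> \<Longrightarrow> l s n \<in> carrier N"
begin

abbreviation "F \<equiv> tensor_free M N"
abbreviation "K \<equiv> tensor_kernel R M r N l"
abbreviation "T \<equiv> tensor R M r N l"
abbreviation "t \<equiv> tens R M r N l"

text \<open>Closure of the two actions keeps the balancing relations inside the free group. The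
  locale asks no more of \<open>r\<close> and \<open>l\<close>, so it covers tensor products over
  \<open>k\<close>, \<open>B\<close> and \<open>A\<close> as well as the triple product.\<close>

lemma rels_closed: "tensor_rels R M r N l \<subseteq> carrier F"
proof -
  interpret M: abelian_group M by (rule left_abelian_group)
  interpret N: abelian_group N by (rule right_abelian_group)
  show ?thesis
    unfolding tensor_free_def tensor_rels_def
    by (auto simp: r_closed l_closed keys_frag_of dest!: keys_diff[THEN subsetD])
qed

lemma F_group: "comm_group F"
  by (simp add: tensor_free_def abelian_free_Abelian_group)

lemma K_subgroup: "subgroup K F"
  unfolding tensor_kernel_def
  by (rule group.generate_is_subgroup[OF comm_group.axioms(2)[OF F_group] rels_closed])

lemma K_normal: "K \<lhd> F"
  by (rule comm_group.subgroup_imp_normal[OF F_group K_subgroup])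

lemma add_monoid_tensor: "add_monoid T = F Mod K"
  by (simp add: tensor_def Let_def)

lemma tensor_abelian_group: "abelian_group T"
proof (rule comm_group_abelian_groupI)
  show "comm_group (add_monoid T)"
  unfolding add_monoid_tensor
  by (rule comm_group.abelian_FactGroup[OF F_group K_subgroup])
qed

lemma carrier_tensor: "carrier T = rcosets\<^bsub>F\<^esub> K"
  using arg_cong[OF add_monoid_tensor, of carrier] by (simp add: FactGroup_def)

lemma tensor_add: "X \<oplus>\<^bsub>T\<^esub> Y = X <#>\<^bsub>F\<^esub> Y"
  using arg_cong[OF add_monoid_tensor, of mult] by (simp add: FactGroup_def)

lemma tensor_zero: "\<zero>\<^bsub>T\<^esub> = K"
  using arg_cong[OF add_monoid_tensor, of one] by (simp add: FactGroup_def)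

lemma carrier_F: "carrier F = {p. Poly_Mapping.keys p \<subseteq> carrier M \<times> carrier N}"
  by (auto simp: tensor_free_def)

lemma mult_F [simp]: "x \<otimes>\<^bsub>F\<^esub> y = x + y"
  by (simp add: tensor_free_def)

lemma inv_F: "x \<in> carrier F \<Longrightarrow> inv\<^bsub>F\<^esub> x = - x"
  by (simp add: tensor_free_def)

lemma frag_of_F [simp]: "frag_of (m, n) \<in> carrier F \<longleftrightarrow> m \<in> carrier M \<and> n \<in> carrier N"
  by (simp add: tensor_free_def)

definition coset :: "('m \<times> 'n \<Rightarrow>\<^sub>0 int) \<Rightarrow> ('m \<times> 'n \<Rightarrow>\<^sub>0 int) set" where
  "coset p = K #>\<^bsub>F\<^esub> p"

lemma coset_closed: "p \<in> carrier F \<Longrightarrow> coset p \<in> carrier T"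
  by (auto simp: carrier_tensor coset_def RCOSETS_def)

lemma coset_add:
  "\<lbrakk>p \<in> carrier F; q \<in> carrier F\<rbrakk> \<Longrightarrow> coset (p + q) = coset p \<oplus>\<^bsub>T\<^esub> coset q"
  using normal.rcos_sum[OF K_normal, of p q] by (simp add: tensor_add coset_def)

lemma coset_hom: "group_hom F (add_monoid T) coset"
proof (intro group_hom.intro group_hom_axioms.intro homI)
  show "Group.group F" by (rule comm_group.axioms(2)[OF F_group])
  show "Group.group (add_monoid T)" by (rule abelian_group.a_group[OF tensor_abelian_group])
qed (auto simp: coset_closed coset_add)

lemma coset_kernel: "p \<in> K \<Longrightarrow> coset p = \<zero>\<^bsub>T\<^esub>"
  unfolding tensor_zero coset_def
  using subgroup.rcos_const[OF K_subgroup _ , of p] F_group comm_group.axioms(2) by blast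

lemma coset_eq:
  assumes p: "p \<in> carrier F" and q: "q \<in> carrier F" and "p - q \<in> K"
  shows "coset p = coset q"
proof -
  interpret T: abelian_group T by (rule tensor_abelian_group)
  have "p - q \<in> carrier F"
    using assms K_subgroup subgroup.mem_carrier by fastforce
  then have "coset ((p - q) + q) = coset (p - q) \<oplus>\<^bsub>T\<^esub> coset q"
    using q by (rule coset_add)
  with assms show ?thesis
    by (simp add: coset_kernel coset_closed)
qed

lemma tens_coset: "t m n = coset (frag_of (m, n))"
  by (simp add: tens_def coset_def)

lemma tens_closed: "\<lbrakk>m \<in> carrier M; n \<in> carrier N\<rbrakk> \<Longrightarrow> t m n \<in> carrier T"
  by (simp add: tens_coset coset_closed)

lemma rel_in_K: "p \<in> tensor_rels R M r N l \<Longrightarrow> p \<in> K"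
  by (simp add: tensor_kernel_def generate.incl)

lemma tens_balanced: "balanced R M r N l T t"
proof -
  interpret M: abelian_group M by (rule left_abelian_group)
  interpret N: abelian_group N by (rule right_abelian_group)
  \<comment> \<open>Both additivity relations have the form of one generator minus two others, so a
    single claim settles them.\<close>
  have add: "t m'' n'' = t m n \<oplus>\<^bsub>T\<^esub> t m' n'"
    if "m \<in> carrier M" "n \<in> carrier N" "m' \<in> carrier M" "n' \<in> carrier N"
       "m'' \<in> carrier M" "n'' \<in> carrier N"
       "frag_of (m'', n'') - frag_of (m, n) - frag_of (m', n') \<in> tensor_rels R M r N l"
    for m n m' n' m'' n''
  proof -
    have "frag_of (m, n) + frag_of (m', n') \<in> carrier F"
      using that by (auto simp: carrier_F keys_frag_of dest!: keys_add[THEN subsetD])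
    then have "t m'' n'' = coset (frag_of (m, n) + frag_of (m', n'))"
      unfolding tens_coset using that
      by (intro coset_eq) (auto intro: rel_in_K simp: diff_diff_eq)
    then show ?thesis
      using that by (simp add: coset_add tens_coset)
  qed
  show ?thesis
  proof (intro balancedI biaddI)
    fix m s n assume "m \<in> carrier M" "s \<in> carrier R" "n \<in> carrier N"
    then show "t (r m s) n = t m (l s n)"
      unfolding tens_coset
      by (intro coset_eq rel_in_K) (auto simp: r_closed l_closed tensor_rels_def)
  next
    fix m m' n assume "m \<in> carrier M" "m' \<in> carrier M" "n \<in> carrier N"
    then show "t (m \<oplus>\<^bsub>M\<^esub> m') n = t m n \<oplus>\<^bsub>T\<^esub> t m' n"
      by (intro add) (auto simp: tensor_rels_def)
  next
    fix m n n' assume "m \<in> carrier M" "n \<in> carrier N" "n' \<in> carrier N"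
    then show "t m (n \<oplus>\<^bsub>N\<^esub> n') = t m n \<oplus>\<^bsub>T\<^esub> t m n'"
      by (intro add) (auto simp: tensor_rels_def)
  qed (simp add: tens_closed)
qed

lemma carrier_tensorE:
  assumes "X \<in> carrier T" obtains p where "p \<in> carrier F" "X = coset p"
  using assms by (auto simp: carrier_tensor coset_def RCOSETS_def)

text \<open>The pure tensors are the images of the free generators, hence generate \<open>T\<close>
  additively. Most identities below are instances, both sides being read as additive functions of
  one tensor.\<close>

lemma add_hom_eqI:
  assumes H: "abelian_group H" and f: "add_hom T H f" and g: "add_hom T H g"
    and eq: "\<And>m n. \<lbrakk>m \<in> carrier M; n \<in> carrier N\<rbrakk> \<Longrightarrow> f (t m n) = g (t m n)"
    and X: "X \<in> carrier T"
  shows "f X = g X"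
proof -
  interpret c: group_hom F "add_monoid T" coset by (rule coset_hom)
  interpret f: group_hom "add_monoid T" "add_monoid H" f
    by (rule add_hom_group_hom[OF tensor_abelian_group H f])
  interpret g: group_hom "add_monoid T" "add_monoid H" g
    by (rule add_hom_group_hom[OF tensor_abelian_group H g])
  obtain p where p: "p \<in> carrier F" and X: "X = coset p"
    using X by (rule carrier_tensorE)
  have "Poly_Mapping.keys p \<subseteq> carrier M \<times> carrier N"
    using p by (simp add: carrier_F)
  then have "f (coset p) = g (coset p)"
  proof (rule free_Abelian_group_induct[where P = "\<lambda>p. f (coset p) = g (coset p)"])
    have "\<one>\<^bsub>F\<^esub> = 0" by (simp add: tensor_free_def)
    then have "coset 0 = \<zero>\<^bsub>T\<^esub>" using c.hom_one by simp
    then show "f (coset 0) = g (coset 0)" using f.hom_one g.hom_one by simp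
  next
    fix x y assume 2: "Poly_Mapping.keys x \<subseteq> carrier M \<times> carrier N"
      "Poly_Mapping.keys y \<subseteq> carrier M \<times> carrier N" "f (coset x) = g (coset x)" "f (coset y) = g (coset y)"
    have "x \<in> carrier F" "y \<in> carrier F" using 2 by (auto simp: carrier_F)
    moreover from this have "x - y = x \<otimes>\<^bsub>F\<^esub> inv\<^bsub>F\<^esub> y" "inv\<^bsub>F\<^esub> y \<in> carrier F"
      by (simp_all add: inv_F carrier_F)
    ultimately show "f (coset (x - y)) = g (coset (x - y))" using 2
      by (metis (no_types, lifting) c.hom_mult c.hom_inv f.hom_mult g.hom_mult f.hom_inv g.hom_inv
          c.hom_closed)
  next
    fix a assume "a \<in> carrier M \<times> carrier N"
    then show "f (coset (frag_of a)) = g (coset (frag_of a))" using eq by (auto simp: tens_coset)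
  qed
  with X show ?thesis by simp
qed

text \<open>This removes the choice hidden in \<open>tensor_lift\<close>: evaluation of a balanced
  function is a homomorphism that kills the relations, hence the subgroup they generate, hence is
  constant on cosets.\<close>

lemma tensor_lift_coset:
  assumes H: "abelian_group H" and f: "balanced R M r N l H f" and p: "p \<in> carrier F"
  shows "tensor_lift H f (coset p) = frag_eval H (\<lambda>z. f (fst z) (snd z)) p"
proof -
  interpret H: abelian_group H by (rule H)
  interpret M: abelian_group M by (rule left_abelian_group)
  interpret N: abelian_group N by (rule right_abelian_group)
  define e where "e = frag_eval H (\<lambda>z. f (fst z) (snd z))"
  have bi: "biadd M N H f" using f by (simp add: balanced_def)
  interpret e: group_hom F "add_monoid H" e
    unfolding e_def tensor_free_def
    by (rule H.frag_eval_hom) (auto intro: biadd_closed[OF bi])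
  have e_of: "e (frag_of (m, n)) = f m n" if "m \<in> carrier M" "n \<in> carrier N" for m n
    unfolding e_def using that by (simp add: H.frag_eval_of biadd_closed[OF bi])
  have e_diff: "e (x - y) = e x \<ominus>\<^bsub>H\<^esub> e y" if "x \<in> carrier F" "y \<in> carrier F" for x y
  proof -
    have eq: "x - y = x \<otimes>\<^bsub>F\<^esub> inv\<^bsub>F\<^esub> y"
      using that by (simp add: inv_F)
    show ?thesis
      unfolding eq using that by (subst e.hom_mult) (simp_all add: a_minus_def a_inv_def)
  qed
  have F_diff: "x - y \<in> carrier F" if "x \<in> carrier F" "y \<in> carrier F" for x y
    using that by (auto simp: carrier_F dest!: keys_diff[THEN subsetD])
  have sub3: "a \<oplus>\<^bsub>H\<^esub> b \<ominus>\<^bsub>H\<^esub> a \<ominus>\<^bsub>H\<^esub> b = \<zero>\<^bsub>H\<^esub>" if "a \<in> carrier H" "b \<in> carrier H" for a b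
  proof -
    have "a \<oplus>\<^bsub>H\<^esub> b \<ominus>\<^bsub>H\<^esub> a \<ominus>\<^bsub>H\<^esub> b = (a \<oplus>\<^bsub>H\<^esub> b) \<oplus>\<^bsub>H\<^esub> \<ominus>\<^bsub>H\<^esub> (a \<oplus>\<^bsub>H\<^esub> b)"
      using that by (simp add: a_minus_def H.minus_add H.a_assoc)
    then show ?thesis using that by (simp add: H.r_neg)
  qed
  have "e x = \<zero>\<^bsub>H\<^esub>" if "x \<in> tensor_rels R M r N l" for x
    using that unfolding tensor_rels_def
  proof (elim UnE CollectE exE conjE)
    fix m m' n
    assume *: "m \<in> carrier M" "m' \<in> carrier M" "n \<in> carrier N"
      and x: "x = frag_of (m \<oplus>\<^bsub>M\<^esub> m', n) - frag_of (m, n) - frag_of (m', n)"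
    have "e x = f (m \<oplus>\<^bsub>M\<^esub> m') n \<ominus>\<^bsub>H\<^esub> f m n \<ominus>\<^bsub>H\<^esub> f m' n"
      using * unfolding x by (simp add: e_diff F_diff e_of)
    then show ?thesis
      using * by (simp add: add_hom_add[OF biadd_left[OF bi]] biadd_closed[OF bi] sub3)
  next
    fix m n n'
    assume *: "m \<in> carrier M" "n \<in> carrier N" "n' \<in> carrier N"
      and x: "x = frag_of (m, n \<oplus>\<^bsub>N\<^esub> n') - frag_of (m, n) - frag_of (m, n')"
    have "e x = f m (n \<oplus>\<^bsub>N\<^esub> n') \<ominus>\<^bsub>H\<^esub> f m n \<ominus>\<^bsub>H\<^esub> f m n'"
      using * unfolding x by (simp add: e_diff F_diff e_of)
    then show ?thesis
      using * by (simp add: add_hom_add[OF biadd_right[OF bi]] biadd_closed[OF bi] sub3)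
  next
    fix m s n
    assume *: "m \<in> carrier M" "s \<in> carrier R" "n \<in> carrier N"
      and x: "x = frag_of (r m s, n) - frag_of (m, l s n)"
    have "e x = f (r m s) n \<ominus>\<^bsub>H\<^esub> f m (l s n)"
      using * unfolding x by (simp add: e_diff e_of r_closed l_closed)
    then show ?thesis
      using * f by (simp add: balanced_def a_minus_def H.r_neg biadd_closed[OF bi] l_closed)
  qed
  then have "tensor_rels R M r N l \<subseteq> kernel F (add_monoid H) e"
    using rels_closed by (auto simp: kernel_def)
  then have "K \<subseteq> kernel F (add_monoid H) e"
    unfolding tensor_kernel_def
    by (intro group.generate_subgroup_incl e.subgroup_kernel) auto
  then have e_K: "e x = \<zero>\<^bsub>H\<^esub>" if "x \<in> K" for x
    using that by (auto simp: kernel_def)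
  \<comment> \<open>The representative that \<open>tensor_lift\<close> actually uses. It differs
    from \<open>p\<close> by an element of \<open>K\<close>, on which \<open>e\<close>
    vanishes.\<close>
  define q where "q = (SOME q. q \<in> coset p)"
  have "0 \<in> K"
    using subgroup.one_closed[OF K_subgroup] by (simp add: tensor_free_def)
  then have "p \<in> coset p"
    using p by (force simp: coset_def r_coset_def)
  then have "q \<in> coset p"
    unfolding q_def by (rule someI)
  then obtain d where d: "d \<in> K" "q = d + p"
    by (auto simp: coset_def r_coset_def)
  then have "d \<in> carrier F" using K_subgroup by (simp add: subgroup.mem_carrier)
  then have "e q = e d \<oplus>\<^bsub>H\<^esub> e p"
    using d(2) p e.hom_mult[of d p] by simp
  also have "\<dots> = e p"
    using e_K[OF d(1)] e.hom_closed[OF p] by simp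
  finally show ?thesis
    by (simp add: tensor_lift_frag_eval q_def e_def)
qed

lemma tensor_lift_tens:
  assumes "abelian_group H" "balanced R M r N l H f" "m \<in> carrier M" "n \<in> carrier N"
  shows "tensor_lift H f (t m n) = f m n"
  using assms
  by (simp add: tens_coset tensor_lift_coset abelian_group.frag_eval_of biadd_closed[OF balanced_biadd])

lemma tensor_lift_add_hom:
  assumes H: "abelian_group H" and f: "balanced R M r N l H f"
  shows "add_hom T H (tensor_lift H f)"
proof -
  interpret H: abelian_group H by (rule H)
  have f_closed: "(\<lambda>z. f (fst z) (snd z)) ` (carrier M \<times> carrier N) \<subseteq> carrier H"
    using f by (auto simp: balanced_def intro: biadd_closed)
  interpret e: group_hom F "add_monoid H" "frag_eval H (\<lambda>z. f (fst z) (snd z))"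
    unfolding tensor_free_def by (rule H.frag_eval_hom[OF f_closed])
  show ?thesis
  proof (rule add_homI)
    fix X assume "X \<in> carrier T"
    then obtain p where "p \<in> carrier F" "X = coset p" by (rule carrier_tensorE)
    then show "tensor_lift H f X \<in> carrier H"
      using e.hom_closed by (simp add: tensor_lift_coset[OF H f])
  next
    fix X Y assume "X \<in> carrier T" "Y \<in> carrier T"
    then obtain p q where pq: "p \<in> carrier F" "X = coset p" "q \<in> carrier F" "Y = coset q"
      by (metis carrier_tensorE)
    then have "X \<oplus>\<^bsub>T\<^esub> Y = coset (p + q)" "p + q \<in> carrier F"
      by (auto simp: coset_add carrier_F dest!: keys_add[THEN subsetD])
    with pq show "tensor_lift H f (X \<oplus>\<^bsub>T\<^esub> Y) = tensor_lift H f X \<oplus>\<^bsub>H\<^esub> tensor_lift H f Y"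
      using e.hom_mult[of p q] by (simp add: tensor_lift_coset[OF H f])
  qed
qed

text \<open>Balancedness of \<open>f\<close> comes for free: on the carriers \<open>f\<close> is
  \<open>g\<close> composed with \<open>t\<close>, and \<open>t\<close> is balanced. It also serves
  to replace an integrand by another one that agrees with it only on carrier elements.\<close>

lemma tensor_lift_unique:
  assumes H: "abelian_group H" and g: "add_hom T H g"
    and eq: "\<And>m n. \<lbrakk>m \<in> carrier M; n \<in> carrier N\<rbrakk> \<Longrightarrow> g (t m n) = f m n"
    and X: "X \<in> carrier T"
  shows "tensor_lift H f X = g X"
proof -
  interpret M: abelian_group M by (rule left_abelian_group)
  interpret N: abelian_group N by (rule right_abelian_group)
  have b: "balanced R M r N l T t" by (rule tens_balanced)
  have "biadd M N H (\<lambda>m n. g (t m n))"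
    by (rule biadd_post[OF balanced_biadd[OF b] g])
  then have "biadd M N H f"
    using eq by (simp add: biadd_def add_hom_def)
  then have f: "balanced R M r N l H f"
  proof (rule balancedI)
    fix m s n assume "m \<in> carrier M" "s \<in> carrier R" "n \<in> carrier N"
    then show "f (r m s) n = f m (l s n)"
      using b eq[of "r m s" n] eq[of m "l s n"] by (simp add: balanced_def r_closed l_closed)
  qed
  show ?thesis
    by (rule add_hom_eqI[OF H tensor_lift_add_hom[OF H f] g _ X])
       (simp add: tensor_lift_tens[OF H f] eq)
qed

text \<open>Meant for lifts whose integrand contains a parameter, as in nested Sweedler sums. The
  sum of the lifts at \<open>p\<close> and at \<open>q\<close> is additive in the tensor, so by
  uniqueness it is the lift at the sum.\<close>

lemma tensor_lift_biadd:
  assumes H: "abelian_group H" and P: "abelian_group P"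
    and f: "\<And>p. p \<in> carrier P \<Longrightarrow> balanced R M r N l H (\<lambda>m n. f m n p)"
    and add: "\<And>m n. \<lbrakk>m \<in> carrier M; n \<in> carrier N\<rbrakk> \<Longrightarrow> add_hom P H (f m n)"
  shows "biadd T P H (\<lambda>X p. tensor_lift H (\<lambda>m n. f m n p) X)"
  unfolding biadd_def
proof (intro conjI ballI)
  interpret H: abelian_group H by (rule H)
  interpret P: abelian_group P by (rule P)
  interpret T: abelian_group T by (rule tensor_abelian_group)
  note lift = tensor_lift_add_hom[OF H f]
  fix X assume X: "X \<in> carrier T"
  show "add_hom P H (\<lambda>p. tensor_lift H (\<lambda>m n. f m n p) X)"
  proof (rule add_homI)
    fix p q assume pq: "p \<in> carrier P" "q \<in> carrier P"
    show "tensor_lift H (\<lambda>m n. f m n (p \<oplus>\<^bsub>P\<^esub> q)) X =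
          tensor_lift H (\<lambda>m n. f m n p) X \<oplus>\<^bsub>H\<^esub> tensor_lift H (\<lambda>m n. f m n q) X"
    proof (rule tensor_lift_unique[OF H _ _ X])
      show "add_hom T H (\<lambda>X. tensor_lift H (\<lambda>m n. f m n p) X \<oplus>\<^bsub>H\<^esub> tensor_lift H (\<lambda>m n. f m n q) X)"
        using add_hom_closed[OF lift] pq
        by (auto intro!: add_homI simp: add_hom_add[OF lift] H.a_ac)
    qed (use pq add in \<open>simp add: tensor_lift_tens[OF H f] add_hom_add[OF add]\<close>)
  qed (use X in \<open>auto intro: add_hom_closed[OF lift]\<close>)
qed (rule tensor_lift_add_hom[OF H f])

end

section \<open>Tensor products of modules and of bimodules\<close>

lemma ring_extend_simps [simp]:
  "carrier (ring.extend T X) = carrier T" "ring.add (ring.extend T X) = ring.add T"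
  "ring.zero (ring.extend T X) = ring.zero T"
  by (simp_all add: ring.defs)

lemma ring_extend_abelian_group:
  assumes "abelian_group T" shows "abelian_group (ring.extend T X)"
proof -
  interpret T: abelian_group T by (rule assms)
  show ?thesis
    by (rule abelian_groupI) (auto simp: T.a_ac intro: T.a_inv_closed T.l_neg)
qed

abbreviation kbalanced ::
  "('k, 'p) ring_scheme \<Rightarrow> ('k, 'm, 'q) module_scheme \<Rightarrow> ('k, 'n, 't) module_scheme \<Rightarrow>
   ('h, 's) ring_scheme \<Rightarrow> ('m \<Rightarrow> 'n \<Rightarrow> 'h) \<Rightarrow> bool" where
  "kbalanced k M N H f \<equiv>
     balanced k M (\<lambda>m s. s \<odot>\<^bsub>M\<^esub> m) N (\<lambda>s n. s \<odot>\<^bsub>N\<^esub> n) H f"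

lemma k_linear_iff:
  "k_linear k M N f \<longleftrightarrow>
     add_hom M N f \<and> (\<forall>s \<in> carrier k. \<forall>x \<in> carrier M. f (s \<odot>\<^bsub>M\<^esub> x) = s \<odot>\<^bsub>N\<^esub> f x)"
  by (simp add: k_linear_def add_hom_iff_hom)

section \<open>Tensor products over the commutative base ring\<close>

locale module_tensor = M: module k M + N: module k N
  for k :: "('k, 'p) ring_scheme" and M :: "('k, 'm, 'q) module_scheme"
    and N :: "('k, 'n, 't) module_scheme"
begin

sublocale tensor_product k M "\<lambda>m s. s \<odot>\<^bsub>M\<^esub> m" N "\<lambda>s n. s \<odot>\<^bsub>N\<^esub> n"
  by unfold_locales auto

abbreviation "P \<equiv> ktensor k M N"

lemma ktensor_simps:
  "carrier P = carrier T" "ring.add P = ring.add T"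
  by (simp_all add: ktensor_def Let_def)

lemma ktens_eq: "t = ktens k M N"
  by (simp add: ktens_def)

text \<open>\<open>ktensor\<close> is another record than the underlying \<open>tensor\<close>, but
  the two share carrier and addition, and the notions of additive and balanced maps read nothing
  else. The universal property can therefore be transferred by rewriting.\<close>

lemma T_ktensor:
  "carrier T = carrier P" "ring.add T = ring.add P" "add_hom T = add_hom P"
  "biadd T = biadd P" "balanced R' M' r' N' l' T = balanced R' M' r' N' l' P"
  by (auto simp: ktensor_simps add_hom_def biadd_def balanced_def fun_eq_iff)

lemmas ktens_closed = tens_closed[unfolded T_ktensor ktens_eq]
lemmas ktens_balanced = tens_balanced[unfolded T_ktensor ktens_eq]
lemmas ktensor_eqI = add_hom_eqI[unfolded T_ktensor ktens_eq]
lemmas ktensor_lift_ktens = tensor_lift_tens[unfolded T_ktensor ktens_eq]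
lemmas ktensor_lift_add_hom = tensor_lift_add_hom[unfolded T_ktensor ktens_eq]
lemmas ktensor_lift_unique = tensor_lift_unique[unfolded T_ktensor ktens_eq]
lemmas ktensor_lift_biadd = tensor_lift_biadd[unfolded T_ktensor ktens_eq]

lemma ktensor_abelian_group: "abelian_group P"
  unfolding ktensor_def Let_def
  by (rule ring_extend_abelian_group[OF tensor_abelian_group])

lemma ktens_add_left:
  "\<lbrakk>m \<in> carrier M; m' \<in> carrier M; n \<in> carrier N\<rbrakk> \<Longrightarrow>
   ktens k M N (m \<oplus>\<^bsub>M\<^esub> m') n = ktens k M N m n \<oplus>\<^bsub>P\<^esub> ktens k M N m' n"
  by (rule add_hom_add[OF biadd_left[OF balanced_biadd[OF ktens_balanced]]])

lemma ktens_add_right: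
  "\<lbrakk>m \<in> carrier M; n \<in> carrier N; n' \<in> carrier N\<rbrakk> \<Longrightarrow>
   ktens k M N m (n \<oplus>\<^bsub>N\<^esub> n') = ktens k M N m n \<oplus>\<^bsub>P\<^esub> ktens k M N m n'"
  by (rule add_hom_add[OF biadd_right[OF balanced_biadd[OF ktens_balanced]]])

lemma ktens_smult_swap:
  "\<lbrakk>m \<in> carrier M; s \<in> carrier k; n \<in> carrier N\<rbrakk> \<Longrightarrow>
   ktens k M N (s \<odot>\<^bsub>M\<^esub> m) n = ktens k M N m (s \<odot>\<^bsub>N\<^esub> n)"
  using ktens_balanced by (simp add: balanced_def)

lemma smult_balanced:
  assumes s: "s \<in> carrier k"
  shows "kbalanced k M N P (\<lambda>m n. ktens k M N (s \<odot>\<^bsub>M\<^esub> m) n)"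
proof (intro balancedI biaddI)
  fix m u n assume *: "m \<in> carrier M" "u \<in> carrier k" "n \<in> carrier N"
  \<comment> \<open>Commutativity of \<open>k\<close> is used here.\<close>
  then have "s \<odot>\<^bsub>M\<^esub> (u \<odot>\<^bsub>M\<^esub> m) = u \<odot>\<^bsub>M\<^esub> (s \<odot>\<^bsub>M\<^esub> m)"
    using s by (simp add: M.m_comm flip: M.smult_assoc1)
  then show "ktens k M N (s \<odot>\<^bsub>M\<^esub> (u \<odot>\<^bsub>M\<^esub> m)) n = ktens k M N (s \<odot>\<^bsub>M\<^esub> m) (u \<odot>\<^bsub>N\<^esub> n)"
    using * s by (simp add: ktens_smult_swap)
qed (use s in \<open>simp_all add: ktens_closed ktens_add_left ktens_add_right M.smult_r_distr\<close>)

lemma smult_eq: "s \<odot>\<^bsub>P\<^esub> X = tensor_lift T (\<lambda>m n. ktens k M N (s \<odot>\<^bsub>M\<^esub> m) n) X"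
  by (simp add: ktensor_def ktens_def Let_def ring.defs)

lemma smult_add_hom: "s \<in> carrier k \<Longrightarrow> add_hom P P (\<lambda>X. s \<odot>\<^bsub>P\<^esub> X)"
  unfolding smult_eq
  using ktensor_lift_add_hom[OF tensor_abelian_group smult_balanced[folded T_ktensor]]
  by (simp add: add_hom_def T_ktensor)

lemma smult_ktens:
  "\<lbrakk>s \<in> carrier k; m \<in> carrier M; n \<in> carrier N\<rbrakk> \<Longrightarrow>
   s \<odot>\<^bsub>P\<^esub> ktens k M N m n = ktens k M N (s \<odot>\<^bsub>M\<^esub> m) n"
  unfolding smult_eq
  by (rule ktensor_lift_ktens[OF tensor_abelian_group smult_balanced[folded T_ktensor]])

lemma ktensor_module: "module k P"
proof -
  interpret P: abelian_group P by (rule ktensor_abelian_group)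
  note hom = smult_add_hom add_hom_closed[OF smult_add_hom] add_hom_add[OF smult_add_hom]
  show ?thesis
  proof (rule moduleI)
    show "cring k" by (rule M.is_cring)
    fix a b x assume a: "a \<in> carrier k" and b: "b \<in> carrier k" and x: "x \<in> carrier P"
    show "(a \<oplus>\<^bsub>k\<^esub> b) \<odot>\<^bsub>P\<^esub> x = a \<odot>\<^bsub>P\<^esub> x \<oplus>\<^bsub>P\<^esub> b \<odot>\<^bsub>P\<^esub> x"
      by (rule ktensor_eqI[OF ktensor_abelian_group _ _ _ x])
         (use a b in \<open>auto simp: hom smult_ktens M.smult_l_distr ktens_add_left P.a_ac intro!: add_homI\<close>)
    show "(a \<otimes>\<^bsub>k\<^esub> b) \<odot>\<^bsub>P\<^esub> x = a \<odot>\<^bsub>P\<^esub> (b \<odot>\<^bsub>P\<^esub> x)"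
      by (rule ktensor_eqI[OF ktensor_abelian_group _ _ _ x])
         (use a b in \<open>auto simp: hom smult_ktens M.smult_assoc1 intro!: add_homI\<close>)
  next
    fix x assume x: "x \<in> carrier P"
    show "\<one>\<^bsub>k\<^esub> \<odot>\<^bsub>P\<^esub> x = x"
      by (rule ktensor_eqI[OF ktensor_abelian_group _ _ _ x])
         (auto simp: hom smult_ktens intro!: add_homI)
  qed (simp_all add: hom ktensor_abelian_group)
qed

lemma k_linear_kbalanced:
  assumes "k_linear k P H f"
  shows "kbalanced k M N H (\<lambda>m n. f (ktens k M N m n))"
proof (rule balancedI)
  show "biadd M N H (\<lambda>m n. f (ktens k M N m n))"
    using biadd_post[OF balanced_biadd[OF ktens_balanced]] assms by (auto simp: k_linear_iff)
qed (simp add: ktens_smult_swap)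

lemma ktensor_lift_k_linear:
  assumes H: "module k H" and f: "kbalanced k M N H f"
    and smult: "\<And>s m n. \<lbrakk>s \<in> carrier k; m \<in> carrier M; n \<in> carrier N\<rbrakk> \<Longrightarrow>
      f (s \<odot>\<^bsub>M\<^esub> m) n = s \<odot>\<^bsub>H\<^esub> f m n"
  shows "k_linear k P H (tensor_lift H f)"
proof -
  interpret H: module k H by (rule H)
  have H': "abelian_group H" ..
  note lift = ktensor_lift_add_hom[OF H' f] ktensor_lift_ktens[OF H' f]
  have sm: "add_hom H H (\<lambda>x. s \<odot>\<^bsub>H\<^esub> x)" if "s \<in> carrier k" for s
    using that by (simp add: add_hom_def H.smult_r_distr)
  show ?thesis
    unfolding k_linear_iff
  proof (intro conjI ballI)
    fix s x assume s: "s \<in> carrier k" and x: "x \<in> carrier P"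
    show "tensor_lift H f (s \<odot>\<^bsub>P\<^esub> x) = s \<odot>\<^bsub>H\<^esub> tensor_lift H f x"
      by (rule ktensor_eqI[OF H' add_hom_comp[OF smult_add_hom[OF s] lift(1)]
            add_hom_comp[OF lift(1) sm[OF s]] _ x])
         (use s in \<open>simp add: smult_ktens lift smult\<close>)
  qed (rule lift(1))
qed

end

text \<open>The part of \<open>coring\<close> that mentions neither comultiplication nor counit. It
  stands alone because the tensor square over \<open>A\<close> and its two actions must be available
  while the axioms for these maps are still to be proved.\<close>

locale bimodule = A: ring A + X: abelian_group X
  for A :: "('a, 'p) ring_scheme" and X :: "('a, 'x, 'q) coring_scheme" +
  assumes lsmult_closed: "\<lbrakk>a \<in> carrier A; x \<in> carrier X\<rbrakk> \<Longrightarrow> a \<odot>\<^bsub>X\<^esub> x \<in> carrier X"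
    and lsmult_l_distr: "\<lbrakk>a \<in> carrier A; b \<in> carrier A; x \<in> carrier X\<rbrakk> \<Longrightarrow>
          (a \<oplus>\<^bsub>A\<^esub> b) \<odot>\<^bsub>X\<^esub> x = a \<odot>\<^bsub>X\<^esub> x \<oplus>\<^bsub>X\<^esub> b \<odot>\<^bsub>X\<^esub> x"
    and lsmult_r_distr: "\<lbrakk>a \<in> carrier A; x \<in> carrier X; y \<in> carrier X\<rbrakk> \<Longrightarrow>
          a \<odot>\<^bsub>X\<^esub> (x \<oplus>\<^bsub>X\<^esub> y) = a \<odot>\<^bsub>X\<^esub> x \<oplus>\<^bsub>X\<^esub> a \<odot>\<^bsub>X\<^esub> y"
    and lsmult_assoc: "\<lbrakk>a \<in> carrier A; b \<in> carrier A; x \<in> carrier X\<rbrakk> \<Longrightarrow>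
          (a \<otimes>\<^bsub>A\<^esub> b) \<odot>\<^bsub>X\<^esub> x = a \<odot>\<^bsub>X\<^esub> (b \<odot>\<^bsub>X\<^esub> x)"
    and lsmult_one: "x \<in> carrier X \<Longrightarrow> \<one>\<^bsub>A\<^esub> \<odot>\<^bsub>X\<^esub> x = x"
    and rsmult_closed: "\<lbrakk>a \<in> carrier A; x \<in> carrier X\<rbrakk> \<Longrightarrow> rsmult X x a \<in> carrier X"
    and rsmult_r_distr: "\<lbrakk>a \<in> carrier A; b \<in> carrier A; x \<in> carrier X\<rbrakk> \<Longrightarrow>
          rsmult X x (a \<oplus>\<^bsub>A\<^esub> b) = rsmult X x a \<oplus>\<^bsub>X\<^esub> rsmult X x b"
    and rsmult_l_distr: "\<lbrakk>a \<in> carrier A; x \<in> carrier X; y \<in> carrier X\<rbrakk> \<Longrightarrow>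
          rsmult X (x \<oplus>\<^bsub>X\<^esub> y) a = rsmult X x a \<oplus>\<^bsub>X\<^esub> rsmult X y a"
    and rsmult_assoc: "\<lbrakk>a \<in> carrier A; b \<in> carrier A; x \<in> carrier X\<rbrakk> \<Longrightarrow>
          rsmult X x (a \<otimes>\<^bsub>A\<^esub> b) = rsmult X (rsmult X x a) b"
    and rsmult_one: "x \<in> carrier X \<Longrightarrow> rsmult X x \<one>\<^bsub>A\<^esub> = x"
    and bimodule: "\<lbrakk>a \<in> carrier A; b \<in> carrier A; x \<in> carrier X\<rbrakk> \<Longrightarrow>
          rsmult X (a \<odot>\<^bsub>X\<^esub> x) b = a \<odot>\<^bsub>X\<^esub> rsmult X x b"
begin

sublocale tensor_product A X "rsmult X" X "smult X"
  by unfold_locales (auto intro: rsmult_closed lsmult_closed)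

abbreviation "Y \<equiv> coring_tensor A X"
abbreviation "Z \<equiv> coring_tensor3 A X"

lemma coring_tensor_simps:
  "carrier Y = carrier T" "ring.add Y = ring.add T"
  by (simp_all add: coring_tensor_def Let_def)

lemma coring_tens_eq: "t = coring_tens A X"
  by (simp add: coring_tens_def)

lemma T_coring_tensor:
  "carrier T = carrier Y" "ring.add T = ring.add Y" "add_hom T = add_hom Y"
  "biadd T = biadd Y" "balanced R' M' r' N' l' T = balanced R' M' r' N' l' Y"
  by (auto simp: coring_tensor_simps add_hom_def biadd_def balanced_def fun_eq_iff)

lemmas ctens_closed = tens_closed[unfolded T_coring_tensor coring_tens_eq]
lemmas ctens_balanced = tens_balanced[unfolded T_coring_tensor coring_tens_eq]
lemmas ctensor_eqI = add_hom_eqI[unfolded T_coring_tensor coring_tens_eq]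
lemmas ctensor_lift_ctens = tensor_lift_tens[unfolded T_coring_tensor coring_tens_eq]
lemmas ctensor_lift_add_hom = tensor_lift_add_hom[unfolded T_coring_tensor coring_tens_eq]
lemmas ctensor_lift_biadd = tensor_lift_biadd[unfolded T_coring_tensor coring_tens_eq]

lemma ctensor_abelian_group: "abelian_group Y"
  unfolding coring_tensor_def Let_def
  by (rule ring_extend_abelian_group[OF tensor_abelian_group])

lemma ctens_biadd: "biadd X X Y (coring_tens A X)"
  by (rule balanced_biadd[OF ctens_balanced])

lemma ctens_swap:
  "\<lbrakk>x \<in> carrier X; a \<in> carrier A; y \<in> carrier X\<rbrakk> \<Longrightarrow>
   coring_tens A X (rsmult X x a) y = coring_tens A X x (a \<odot>\<^bsub>X\<^esub> y)"
  using ctens_balanced by (simp add: balanced_def)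

lemma lsmult_add_hom: "a \<in> carrier A \<Longrightarrow> add_hom X X (smult X a)"
  by (simp add: add_hom_def lsmult_closed lsmult_r_distr)

lemma rsmult_add_hom: "a \<in> carrier A \<Longrightarrow> add_hom X X (\<lambda>x. rsmult X x a)"
  by (simp add: add_hom_def rsmult_closed rsmult_l_distr)

text \<open>Since the two actions commute, a (x b) \<otimes> y = (a x) b \<otimes> y = a x \<otimes>
  b y. The right action on the tensor square is justified in the same way.\<close>

lemma ctensor_smult_balanced:
  "a \<in> carrier A \<Longrightarrow>
   balanced A X (rsmult X) X (smult X) Y (\<lambda>x y. coring_tens A X (a \<odot>\<^bsub>X\<^esub> x) y)"
  by (intro balancedI biadd_comp[OF ctens_biadd lsmult_add_hom add_hom_ident])
     (simp_all add: ctens_swap lsmult_closed flip: bimodule)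

lemma ctensor_smult_eq:
  "a \<odot>\<^bsub>Y\<^esub> u = tensor_lift T (\<lambda>x y. coring_tens A X (a \<odot>\<^bsub>X\<^esub> x) y) u"
  by (simp add: coring_tensor_def coring_tens_def Let_def ring.defs)

lemma ctensor_smult_add_hom: "a \<in> carrier A \<Longrightarrow> add_hom Y Y (smult Y a)"
  using ctensor_lift_add_hom[OF tensor_abelian_group ctensor_smult_balanced[folded T_coring_tensor]]
  by (simp add: add_hom_def T_coring_tensor ctensor_smult_eq)

lemma ctensor_smult_ctens:
  "\<lbrakk>a \<in> carrier A; x \<in> carrier X; y \<in> carrier X\<rbrakk> \<Longrightarrow>
   a \<odot>\<^bsub>Y\<^esub> coring_tens A X x y = coring_tens A X (a \<odot>\<^bsub>X\<^esub> x) y"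
  unfolding ctensor_smult_eq
  by (rule ctensor_lift_ctens[OF tensor_abelian_group ctensor_smult_balanced[folded T_coring_tensor]])

lemma ctensor_rsmult_balanced:
  "a \<in> carrier A \<Longrightarrow>
   balanced A X (rsmult X) X (smult X) Y (\<lambda>x y. coring_tens A X x (rsmult X y a))"
  by (intro balancedI biadd_comp[OF ctens_biadd add_hom_ident rsmult_add_hom])
     (simp_all add: ctens_swap rsmult_closed bimodule)

lemma ctensor_rsmult_add_hom:
  "a \<in> carrier A \<Longrightarrow> add_hom Y Y (\<lambda>u. coring_tensor_rsmult A X u a)"
  unfolding coring_tensor_rsmult_def
  by (rule ctensor_lift_add_hom[OF ctensor_abelian_group ctensor_rsmult_balanced])

lemma ctensor_rsmult_ctens:
  "\<lbrakk>a \<in> carrier A; x \<in> carrier X; y \<in> carrier X\<rbrakk> \<Longrightarrow>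
   coring_tensor_rsmult A X (coring_tens A X x y) a = coring_tens A X x (rsmult X y a)"
  unfolding coring_tensor_rsmult_def
  by (rule ctensor_lift_ctens[OF ctensor_abelian_group ctensor_rsmult_balanced])

lemma triple: "tensor_product A X (rsmult X) Y (smult Y)"
  by (rule tensor_product.intro)
     (auto intro: rsmult_closed ctensor_abelian_group X.abelian_group_axioms
       add_hom_closed[OF ctensor_smult_add_hom])

lemmas ctensor3_abelian_group =
  tensor_product.tensor_abelian_group[OF triple, folded coring_tensor3_def]
lemmas ctens3_balanced =
  tensor_product.tens_balanced[OF triple, folded coring_tensor3_def coring_tens3_def]

end

section \<open>The bimodule \<open>A \<otimes> C\<close> of an entwining map\<close>

locale algebra_coalgebra = A: k_algebra k A + C: coalgebra k C
  for k :: "('k, 'p) ring_scheme" and A :: "('k, 'a, 'q) module_scheme"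
    and C :: "('k, 'c, 't) coalgebra_scheme"
begin

sublocale AC: module_tensor k A C
  by (intro module_tensor.intro A.module_axioms C.module_axioms)

sublocale CA: module_tensor k C A
  by (intro module_tensor.intro A.module_axioms C.module_axioms)

sublocale CC: module_tensor k C C
  by (intro module_tensor.intro C.module_axioms)

sublocale ACC: module_tensor k A "ktensor k C C"
  by (intro module_tensor.intro A.module_axioms CC.ktensor_module)

abbreviation "M \<equiv> ktensor k A C"
abbreviation "D \<equiv> ktensor k C C"
abbreviation "W \<equiv> ktensor k A D"
abbreviation "ac \<equiv> ktens k A C"
abbreviation "ca \<equiv> ktens k C A"
abbreviation "cc \<equiv> ktens k C C"
abbreviation "acc \<equiv> ktens k A D"
abbreviation "lm \<equiv> left_mult_tensor k A C"

sublocale M: module k M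
  by (rule AC.ktensor_module)

sublocale D: module k D
  by (rule CC.ktensor_module)

sublocale W: module k W
  by (rule ACC.ktensor_module)

lemma ab_groups: "abelian_group A" "abelian_group C" "abelian_group M" "abelian_group D" "abelian_group W"
  by unfold_locales

lemma comult_k_linear: "k_linear k C D (comult C)"
  by (rule C.comult_linear)

lemma comult_add_hom: "add_hom C D (comult C)"
  using C.comult_linear by (simp add: k_linear_iff)

lemma comult_closed: "c \<in> carrier C \<Longrightarrow> comult C c \<in> carrier D"
  by (rule add_hom_closed[OF comult_add_hom])

lemma A_mult_biadd: "biadd A A A (mult A)"
  by (intro biaddI) (simp_all add: A.l_distr A.r_distr)

lemma ac_biadd: "biadd A C M ac"
  by (rule balanced_biadd[OF AC.ktens_balanced])

lemma cc_biadd: "biadd C C D cc"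
  by (rule balanced_biadd[OF CC.ktens_balanced])

lemma acc_biadd: "biadd A D W acc"
  by (rule balanced_biadd[OF ACC.ktens_balanced])

lemma lm_balanced:
  "a \<in> carrier A \<Longrightarrow> kbalanced k A C M (\<lambda>b c. ac (a \<otimes>\<^bsub>A\<^esub> b) c)"
  by (intro balancedI biadd_comp[OF ac_biadd biadd_right[OF A_mult_biadd] add_hom_ident])
     (simp_all add: A.smult_mult_right AC.ktens_smult_swap)

lemma lm_add_hom: "a \<in> carrier A \<Longrightarrow> add_hom M M (lm a)"
  unfolding left_mult_tensor_def
  by (rule AC.ktensor_lift_add_hom[OF ab_groups(3) lm_balanced])

lemma lm_ac:
  "\<lbrakk>a \<in> carrier A; b \<in> carrier A; c \<in> carrier C\<rbrakk> \<Longrightarrow> lm a (ac b c) = ac (a \<otimes>\<^bsub>A\<^esub> b) c"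
  unfolding left_mult_tensor_def
  by (rule AC.ktensor_lift_ktens[OF ab_groups(3) lm_balanced])

lemma lm_biadd: "biadd A M M lm"
proof -
  have "biadd M A M (\<lambda>m a. lm a m)"
    unfolding left_mult_tensor_def
  proof (rule AC.ktensor_lift_biadd[OF ab_groups(3,1) lm_balanced])
    fix b c assume "b \<in> carrier A" "c \<in> carrier C"
    then show "add_hom A M (\<lambda>a. ac (a \<otimes>\<^bsub>A\<^esub> b) c)"
      by (intro add_hom_comp[OF biadd_left[OF A_mult_biadd] biadd_left[OF ac_biadd]])
  qed
  then show ?thesis by (rule biadd_flip)
qed

lemma lm_closed: "\<lbrakk>a \<in> carrier A; m \<in> carrier M\<rbrakk> \<Longrightarrow> lm a m \<in> carrier M"
  by (rule biadd_closed[OF lm_biadd])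

lemma lm_assoc:
  assumes "a \<in> carrier A" "b \<in> carrier A" and m: "m \<in> carrier M"
  shows "lm (a \<otimes>\<^bsub>A\<^esub> b) m = lm a (lm b m)"
  by (rule AC.ktensor_eqI[OF ab_groups(3) lm_add_hom add_hom_comp[OF lm_add_hom lm_add_hom] _ m])
     (use assms in \<open>simp_all add: lm_ac A.m_assoc\<close>)

lemma lm_one: "m \<in> carrier M \<Longrightarrow> lm \<one>\<^bsub>A\<^esub> m = m"
  by (rule AC.ktensor_eqI[OF ab_groups(3) lm_add_hom add_hom_ident]) (simp_all add: lm_ac)

lemma lm_smult_left:
  assumes "s \<in> carrier k" "a \<in> carrier A" and m: "m \<in> carrier M"
  shows "lm (s \<odot>\<^bsub>A\<^esub> a) m = s \<odot>\<^bsub>M\<^esub> lm a m"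
  by (rule AC.ktensor_eqI[OF ab_groups(3) lm_add_hom add_hom_comp[OF lm_add_hom AC.smult_add_hom] _ m])
     (use assms in \<open>simp_all add: lm_ac AC.smult_ktens A.smult_mult_left\<close>)

lemma lm_smult_right:
  assumes "s \<in> carrier k" "a \<in> carrier A" and m: "m \<in> carrier M"
  shows "lm a (s \<odot>\<^bsub>M\<^esub> m) = s \<odot>\<^bsub>M\<^esub> lm a m"
  by (rule AC.ktensor_eqI[OF ab_groups(3) add_hom_comp[OF AC.smult_add_hom lm_add_hom]
        add_hom_comp[OF lm_add_hom AC.smult_add_hom] _ m])
     (use assms in \<open>simp_all add: lm_ac AC.smult_ktens A.smult_mult_right\<close>)

text \<open>\<open>(a \<otimes> c') \<otimes> c \<mapsto> a \<otimes> (c' \<otimes> c)\<close>: triple tensors are bracketed to the right.\<close>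

definition append_right :: "('a \<times> 'c \<Rightarrow>\<^sub>0 int) set \<Rightarrow> 'c \<Rightarrow> ('a \<times> ('c \<times> 'c \<Rightarrow>\<^sub>0 int) set \<Rightarrow>\<^sub>0 int) set" where
  "append_right m c = tensor_lift W (\<lambda>a c'. acc a (cc c' c)) m"

lemma append_right_balanced:
  "c \<in> carrier C \<Longrightarrow> kbalanced k A C W (\<lambda>a c'. acc a (cc c' c))"
  by (intro balancedI biadd_comp[OF acc_biadd add_hom_ident biadd_left[OF cc_biadd]])
     (simp_all add: ACC.ktens_smult_swap CC.ktens_closed CC.smult_ktens)

lemma append_right_ac:
  "\<lbrakk>a \<in> carrier A; c' \<in> carrier C; c \<in> carrier C\<rbrakk> \<Longrightarrow> append_right (ac a c') c = acc a (cc c' c)"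
  unfolding append_right_def by (rule AC.ktensor_lift_ktens[OF ab_groups(5) append_right_balanced])

lemma append_right_biadd: "biadd M C W append_right"
  unfolding append_right_def
  by (rule AC.ktensor_lift_biadd[OF ab_groups(5,2) append_right_balanced], assumption)
     (rule add_hom_comp[OF biadd_right[OF cc_biadd] biadd_right[OF acc_biadd]])

lemma append_right_kbalanced: "kbalanced k M C W append_right"
proof (rule balancedI[OF append_right_biadd])
  fix m s c assume m: "m \<in> carrier M" and "s \<in> carrier k" "c \<in> carrier C"
  then show "append_right (s \<odot>\<^bsub>M\<^esub> m) c = append_right m (s \<odot>\<^bsub>C\<^esub> c)"
    by (intro AC.ktensor_eqI[OF ab_groups(5) add_hom_comp[OF AC.smult_add_hom biadd_left[OF append_right_biadd]]
         biadd_left[OF append_right_biadd] _ m])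
      (simp_all add: AC.smult_ktens append_right_ac CC.smult_ktens CC.ktens_closed ACC.ktens_smult_swap CC.ktens_smult_swap)
qed

definition id_comult :: "('a \<times> 'c \<Rightarrow>\<^sub>0 int) set \<Rightarrow> ('a \<times> ('c \<times> 'c \<Rightarrow>\<^sub>0 int) set \<Rightarrow>\<^sub>0 int) set" where
  "id_comult m = tensor_lift W (\<lambda>a c. acc a (comult C c)) m"

lemma id_comult_balanced: "kbalanced k A C W (\<lambda>a c. acc a (comult C c))"
  using comult_k_linear
  by (intro balancedI biadd_comp[OF acc_biadd add_hom_ident comult_add_hom])
     (simp_all add: ACC.ktens_smult_swap comult_closed k_linear_iff)

lemma id_comult_add_hom: "add_hom M W id_comult"
  unfolding id_comult_def[abs_def] by (rule AC.ktensor_lift_add_hom[OF ab_groups(5) id_comult_balanced])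

lemma id_comult_ac: "\<lbrakk>a \<in> carrier A; c \<in> carrier C\<rbrakk> \<Longrightarrow> id_comult (ac a c) = acc a (comult C c)"
  unfolding id_comult_def by (rule AC.ktensor_lift_ktens[OF ab_groups(5) id_comult_balanced])

definition id_counit :: "('a \<times> 'c \<Rightarrow>\<^sub>0 int) set \<Rightarrow> 'a" where
  "id_counit m = tensor_lift A (\<lambda>a c. counit C c \<odot>\<^bsub>A\<^esub> a) m"

lemma counit_add_hom: "add_hom C k (counit C)"
  using C.counit_add by (simp add: add_hom_iff_hom)

lemma counit_closed: "c \<in> carrier C \<Longrightarrow> counit C c \<in> carrier k"
  by (rule add_hom_closed[OF counit_add_hom])

lemma id_counit_balanced: "kbalanced k A C A (\<lambda>a c. counit C c \<odot>\<^bsub>A\<^esub> a)"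
  by (intro balancedI biaddI)
     (simp_all add: counit_closed A.smult_r_distr A.smult_l_distr add_hom_add[OF counit_add_hom]
        C.counit_smult A.m_comm flip: A.smult_assoc1)

lemma id_counit_add_hom: "add_hom M A id_counit"
  unfolding id_counit_def[abs_def] by (rule AC.ktensor_lift_add_hom[OF ab_groups(1) id_counit_balanced])

lemma id_counit_ac: "\<lbrakk>a \<in> carrier A; c \<in> carrier C\<rbrakk> \<Longrightarrow> id_counit (ac a c) = counit C c \<odot>\<^bsub>A\<^esub> a"
  unfolding id_counit_def by (rule AC.ktensor_lift_ktens[OF ab_groups(1) id_counit_balanced])

lemma id_counit_lm:
  assumes "a \<in> carrier A" and m: "m \<in> carrier M"
  shows "id_counit (lm a m) = a \<otimes>\<^bsub>A\<^esub> id_counit m"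
  by (rule AC.ktensor_eqI[OF ab_groups(1) add_hom_comp[OF lm_add_hom id_counit_add_hom]
        add_hom_comp[OF id_counit_add_hom biadd_right[OF A_mult_biadd]] _ m])
     (use assms in \<open>simp_all add: lm_ac id_counit_ac A.smult_mult_right counit_closed\<close>)

end

text \<open>
  The two entwining axioms that only involve \<open>A\<close> are exactly what makes \<open>A \<otimes> C\<close> a bimodule;
  the comparison of \<open>(A \<otimes> C) \<otimes>\<^sub>A (A \<otimes> C)\<close> with \<open>A \<otimes> C \<otimes> C\<close> needs nothing more.
\<close>

locale pre_entwining = algebra_coalgebra k A C
  for k :: "('k, 'p) ring_scheme" and A :: "('k, 'a, 'q) module_scheme"
    and C :: "('k, 'c, 't) coalgebra_scheme"
    and \<psi> :: "('c \<times> 'a \<Rightarrow>\<^sub>0 int) set \<Rightarrow> ('a \<times> 'c \<Rightarrow>\<^sub>0 int) set" +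
  assumes psi_linear: "k_linear k (ktensor k C A) (ktensor k A C) \<psi>"
    and psi_mult: "\<lbrakk>a \<in> carrier A; b \<in> carrier A; c \<in> carrier C\<rbrakk> \<Longrightarrow>
          \<psi> (ktens k C A c (a \<otimes>\<^bsub>A\<^esub> b)) =
          tensor_lift (ktensor k A C)
            (\<lambda>a' c'. left_mult_tensor k A C a' (\<psi> (ktens k C A c' b)))
            (\<psi> (ktens k C A c a))"
    and psi_one: "c \<in> carrier C \<Longrightarrow> \<psi> (ktens k C A c \<one>\<^bsub>A\<^esub>) = ktens k A C \<one>\<^bsub>A\<^esub> c"
begin

section \<open>The right action determined by \<psi>\<close>

definition right_mult :: "('a \<times> 'c \<Rightarrow>\<^sub>0 int) set \<Rightarrow> 'a \<Rightarrow> ('a \<times> 'c \<Rightarrow>\<^sub>0 int) set" where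
  "right_mult m a = tensor_lift M (\<lambda>b c. lm b (\<psi> (ca c a))) m"

lemma psi_balanced: "kbalanced k C A M (\<lambda>c a. \<psi> (ca c a))"
  by (rule CA.k_linear_kbalanced[OF psi_linear])

lemma psi_biadd: "biadd C A M (\<lambda>c a. \<psi> (ca c a))"
  by (rule balanced_biadd[OF psi_balanced])

lemma psi_closed: "\<lbrakk>c \<in> carrier C; a \<in> carrier A\<rbrakk> \<Longrightarrow> \<psi> (ca c a) \<in> carrier M"
  by (rule biadd_closed[OF psi_biadd])

lemma psi_smult:
  assumes "s \<in> carrier k" "c \<in> carrier C" "a \<in> carrier A"
  shows "\<psi> (ca (s \<odot>\<^bsub>C\<^esub> c) a) = s \<odot>\<^bsub>M\<^esub> \<psi> (ca c a)"
    and "\<psi> (ca c (s \<odot>\<^bsub>A\<^esub> a)) = s \<odot>\<^bsub>M\<^esub> \<psi> (ca c a)"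
  using assms psi_linear
  by (simp_all add: k_linear_iff CA.ktens_closed flip: CA.smult_ktens CA.ktens_smult_swap)

lemma right_mult_balanced:
  "a \<in> carrier A \<Longrightarrow> kbalanced k A C M (\<lambda>b c. lm b (\<psi> (ca c a)))"
  by (intro balancedI biadd_comp[OF lm_biadd add_hom_ident biadd_left[OF psi_biadd]])
     (simp_all add: lm_smult_left lm_smult_right psi_closed psi_smult)

lemma right_mult_ac:
  "\<lbrakk>b \<in> carrier A; c \<in> carrier C; a \<in> carrier A\<rbrakk> \<Longrightarrow> right_mult (ac b c) a = lm b (\<psi> (ca c a))"
  unfolding right_mult_def by (rule AC.ktensor_lift_ktens[OF ab_groups(3) right_mult_balanced])

lemma right_mult_biadd: "biadd M A M right_mult"
  unfolding right_mult_def[abs_def]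
  by (rule AC.ktensor_lift_biadd[OF ab_groups(3,1) right_mult_balanced], assumption)
     (rule add_hom_comp[OF biadd_right[OF psi_biadd] biadd_right[OF lm_biadd]])

lemma right_mult_closed: "\<lbrakk>m \<in> carrier M; a \<in> carrier A\<rbrakk> \<Longrightarrow> right_mult m a \<in> carrier M"
  by (rule biadd_closed[OF right_mult_biadd])

lemma right_mult_lm:
  assumes "a \<in> carrier A" "b \<in> carrier A" and m: "m \<in> carrier M"
  shows "right_mult (lm a m) b = lm a (right_mult m b)"
  by (rule AC.ktensor_eqI[OF ab_groups(3) add_hom_comp[OF lm_add_hom biadd_left[OF right_mult_biadd]]
        add_hom_comp[OF biadd_left[OF right_mult_biadd] lm_add_hom] _ m])
     (use assms in \<open>simp_all add: lm_ac right_mult_ac lm_assoc psi_closed\<close>)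

lemma right_mult_one: "m \<in> carrier M \<Longrightarrow> right_mult m \<one>\<^bsub>A\<^esub> = m"
  by (rule AC.ktensor_eqI[OF ab_groups(3) biadd_left[OF right_mult_biadd] add_hom_ident])
     (simp_all add: right_mult_ac psi_one lm_ac)

text \<open>On a pure tensor b \<otimes> c the left factor b comes out by
  \<open>right_mult_lm\<close>, and what remains is \<open>psi_mult\<close>.\<close>

lemma right_mult_assoc:
  assumes "a \<in> carrier A" "b \<in> carrier A" and m: "m \<in> carrier M"
  shows "right_mult m (a \<otimes>\<^bsub>A\<^esub> b) = right_mult (right_mult m a) b"
  by (rule AC.ktensor_eqI[OF ab_groups(3) biadd_left[OF right_mult_biadd]
        add_hom_comp[OF biadd_left[OF right_mult_biadd] biadd_left[OF right_mult_biadd]] _ m])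
     (use assms in \<open>simp_all add: right_mult_ac right_mult_lm psi_closed psi_mult flip: right_mult_def\<close>)

lemma right_mult_smult_right:
  assumes "s \<in> carrier k" "a \<in> carrier A" and m: "m \<in> carrier M"
  shows "right_mult m (s \<odot>\<^bsub>A\<^esub> a) = s \<odot>\<^bsub>M\<^esub> right_mult m a"
  by (rule AC.ktensor_eqI[OF ab_groups(3) biadd_left[OF right_mult_biadd]
        add_hom_comp[OF biadd_left[OF right_mult_biadd] AC.smult_add_hom] _ m])
     (use assms in \<open>simp_all add: right_mult_ac psi_smult lm_smult_right psi_closed\<close>)

section \<open>The associated coring and its tensor square over A\<close>

abbreviation "X \<equiv> entwining_coring k A C \<psi>"
abbreviation "Y \<equiv> coring_tensor A X"
abbreviation "ct \<equiv> coring_tens A X"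

lemma X_simps [simp]:
  "carrier X = carrier M" "ring.add X = ring.add M" "ring.zero X = ring.zero M"
  "smult X = lm" "rsmult X = right_mult"
  by (simp_all add: entwining_coring_def entwining_bimodule_def Let_def right_mult_def fun_eq_iff)

lemma X_homs [simp]:
  "add_hom X = add_hom M" "add_hom N X = add_hom N M"
  "biadd X = biadd M" "biadd N X = biadd N M" "biadd N N' X = biadd N N' M"
  by (simp_all add: add_hom_def biadd_def fun_eq_iff)

lemma X_bimodule: "bimodule A X"
proof (intro bimodule.intro bimodule_axioms.intro)
  show "abelian_group X"
    by (rule abelian_groupI) (auto simp: M.a_ac intro: M.add.inv_closed M.l_neg)
qed (simp_all add: A.ring_axioms lm_closed right_mult_closed lm_assoc lm_one right_mult_one right_mult_assoc right_mult_lm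
      add_hom_add[OF biadd_left[OF lm_biadd]] add_hom_add[OF biadd_right[OF lm_biadd]]
      add_hom_add[OF biadd_left[OF right_mult_biadd]] add_hom_add[OF biadd_right[OF right_mult_biadd]])

interpretation X: bimodule A X
  by (rule X_bimodule)

lemma X_abelian_group: "abelian_group X"
  by (rule X.X.abelian_group_axioms)

lemmas Y_abelian_group = X.ctensor_abelian_group
lemmas ct_closed = X.ctens_closed[unfolded X_simps X_homs]
lemmas ct_biadd = X.ctens_biadd[unfolded X_simps X_homs]
lemmas ct_swap = X.ctens_swap[unfolded X_simps X_homs]
lemmas Y_eqI = X.ctensor_eqI[unfolded X_simps X_homs]
lemmas Y_lift_add_hom = X.ctensor_lift_add_hom
lemmas Y_smult_add_hom = X.ctensor_smult_add_hom
lemmas Y_smult_ct = X.ctensor_smult_ctens[unfolded X_simps X_homs]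
lemmas Y_rsmult_add_hom = X.ctensor_rsmult_add_hom
lemmas Y_rsmult_ct = X.ctensor_rsmult_ctens[unfolded X_simps X_homs]
lemmas Z_abelian_group = X.ctensor3_abelian_group
lemmas Z_balanced = X.ctens3_balanced[unfolded X_simps]

lemma smult_eq_lm: "\<lbrakk>s \<in> carrier k; m \<in> carrier M\<rbrakk> \<Longrightarrow> s \<odot>\<^bsub>M\<^esub> m = lm (s \<odot>\<^bsub>A\<^esub> \<one>\<^bsub>A\<^esub>) m"
  by (simp add: lm_smult_left lm_one)

lemma smult_eq_rm: "\<lbrakk>s \<in> carrier k; m \<in> carrier M\<rbrakk> \<Longrightarrow> s \<odot>\<^bsub>M\<^esub> m = right_mult m (s \<odot>\<^bsub>A\<^esub> \<one>\<^bsub>A\<^esub>)"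
  by (simp add: right_mult_smult_right right_mult_one)

text \<open>A scalar s acts on \<open>M\<close> both as left and as right multiplication by s 1, so
  balancedness over \<open>A\<close> specializes to balancedness over \<open>k\<close>.\<close>

lemma ct_kbalanced: "kbalanced k M M Y ct"
proof (rule balancedI[OF ct_biadd])
  fix m s n assume *: "m \<in> carrier M" "s \<in> carrier k" "n \<in> carrier M"
  then have "ct (right_mult m (s \<odot>\<^bsub>A\<^esub> \<one>\<^bsub>A\<^esub>)) n = ct m (lm (s \<odot>\<^bsub>A\<^esub> \<one>\<^bsub>A\<^esub>) n)"
    by (simp add: ct_swap)
  then show "ct (s \<odot>\<^bsub>M\<^esub> m) n = ct m (s \<odot>\<^bsub>M\<^esub> n)"
    using * by (simp only: smult_eq_lm[of s n] smult_eq_rm[of s m])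
qed

text \<open>The identification of A \<otimes> C \<otimes> C with the tensor square, in the direction
  in which the coring comultiplication uses it. It lets that comultiplication be factored as
  \<open>eta\<close> after \<open>id_comult\<close>.\<close>

definition eta :: "('a \<times> ('c \<times> 'c \<Rightarrow>\<^sub>0 int) set \<Rightarrow>\<^sub>0 int) set \<Rightarrow>
    (('a \<times> 'c \<Rightarrow>\<^sub>0 int) set \<times> ('a \<times> 'c \<Rightarrow>\<^sub>0 int) set \<Rightarrow>\<^sub>0 int) set" where
  "eta w = tensor_lift Y
     (\<lambda>a u. tensor_lift Y (\<lambda>c1 c2. ct (ac a c1) (ac \<one>\<^bsub>A\<^esub> c2)) u) w"

lemma eta_balanced_inner:
  assumes a: "a \<in> carrier A"
  shows "kbalanced k C C Y (\<lambda>c1 c2. ct (ac a c1) (ac \<one>\<^bsub>A\<^esub> c2))"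
proof (rule balancedI)
  show "biadd C C Y (\<lambda>c1 c2. ct (ac a c1) (ac \<one>\<^bsub>A\<^esub> c2))"
    by (rule biadd_comp[OF ct_biadd biadd_right[OF ac_biadd a] biadd_right[OF ac_biadd A.one_closed]])
  fix c1 s c2 assume *: "c1 \<in> carrier C" "s \<in> carrier k" "c2 \<in> carrier C"
  have "ct (ac a (s \<odot>\<^bsub>C\<^esub> c1)) (ac \<one>\<^bsub>A\<^esub> c2) = ct (s \<odot>\<^bsub>M\<^esub> ac a c1) (ac \<one>\<^bsub>A\<^esub> c2)"
    using a * by (simp add: AC.smult_ktens AC.ktens_smult_swap)
  also have "\<dots> = ct (ac a c1) (s \<odot>\<^bsub>M\<^esub> ac \<one>\<^bsub>A\<^esub> c2)"
    using ct_kbalanced a * by (simp add: balanced_def AC.ktens_closed)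
  also have "\<dots> = ct (ac a c1) (ac \<one>\<^bsub>A\<^esub> (s \<odot>\<^bsub>C\<^esub> c2))"
    using a * by (simp add: AC.smult_ktens AC.ktens_smult_swap)
  finally show "ct (ac a (s \<odot>\<^bsub>C\<^esub> c1)) (ac \<one>\<^bsub>A\<^esub> c2) = ct (ac a c1) (ac \<one>\<^bsub>A\<^esub> (s \<odot>\<^bsub>C\<^esub> c2))" .
qed

abbreviation "eta1 a \<equiv> tensor_lift Y (\<lambda>c1 c2. ct (ac a c1) (ac \<one>\<^bsub>A\<^esub> c2))"

lemma eta1_add_hom: "a \<in> carrier A \<Longrightarrow> add_hom D Y (eta1 a)"
  by (rule CC.ktensor_lift_add_hom[OF Y_abelian_group eta_balanced_inner])

lemma eta1_cc:
  "\<lbrakk>a \<in> carrier A; c \<in> carrier C; c' \<in> carrier C\<rbrakk> \<Longrightarrow> eta1 a (cc c c') = ct (ac a c) (ac \<one>\<^bsub>A\<^esub> c')"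
  by (rule CC.ktensor_lift_ktens[OF Y_abelian_group eta_balanced_inner])

lemma eta_balanced: "kbalanced k A D Y eta1"
proof (rule balancedI)
  have "biadd D A Y (\<lambda>u a. eta1 a u)"
    by (rule CC.ktensor_lift_biadd[OF Y_abelian_group ab_groups(1) eta_balanced_inner], assumption)
       (intro add_hom_comp[OF biadd_left[OF ac_biadd] biadd_left[OF ct_biadd]] AC.ktens_closed, simp_all)
  then show "biadd A D Y eta1"
    by (rule biadd_flip)
  fix a s u assume a: "a \<in> carrier A" and s: "s \<in> carrier k" and u: "u \<in> carrier D"
  have "s \<odot>\<^bsub>A\<^esub> a \<in> carrier A" using a s by simp
  then show "eta1 (s \<odot>\<^bsub>A\<^esub> a) u = eta1 a (s \<odot>\<^bsub>D\<^esub> u)"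
    by (rule CC.ktensor_eqI[OF Y_abelian_group eta1_add_hom
          add_hom_comp[OF CC.smult_add_hom[OF s] eta1_add_hom[OF a]] _ u])
       (use a s in \<open>simp add: eta1_cc CC.smult_ktens AC.ktens_smult_swap\<close>)
qed

lemma eta_add_hom: "add_hom W Y eta"
  unfolding eta_def[abs_def]
  by (rule ACC.ktensor_lift_add_hom[OF Y_abelian_group eta_balanced])

lemma eta_acc: "\<lbrakk>a \<in> carrier A; u \<in> carrier D\<rbrakk> \<Longrightarrow> eta (acc a u) = eta1 a u"
  unfolding eta_def by (rule ACC.ktensor_lift_ktens[OF Y_abelian_group eta_balanced])

lemma eta_append_right:
  assumes c: "c \<in> carrier C" and m: "m \<in> carrier M"
  shows "eta (append_right m c) = ct m (ac \<one>\<^bsub>A\<^esub> c)"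
  by (rule AC.ktensor_eqI[OF Y_abelian_group add_hom_comp[OF biadd_left[OF append_right_biadd c] eta_add_hom]
        biadd_left[OF ct_biadd] _ m])
     (use c in \<open>simp_all add: AC.ktens_closed append_right_ac eta_acc CC.ktens_closed eta1_cc\<close>)

text \<open>Filling in comultiplication and counit leaves untouched all fields that the tensor
  square reads. Hence \<open>cor_comult\<close> may be regarded as a map into the tensor square of
  \<open>X\<close> itself.\<close>

lemma coring_tensor_bimodule: "coring_tensor A (entwining_bimodule k A C \<psi>) = Y"
  by (simp add: entwining_coring_def Let_def coring_tensor_def tensor_def tensor_free_def
      tensor_kernel_def tensor_rels_def tens_def)

lemma coring_tens_bimodule: "coring_tens A (entwining_bimodule k A C \<psi>) = ct"
  by (simp add: entwining_coring_def Let_def coring_tens_def tensor_free_def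
      tensor_kernel_def tensor_rels_def tens_def fun_eq_iff)

lemma cor_comult_eq: "cor_comult X = tensor_lift Y (\<lambda>a c. eta1 a (comult C c))"
  unfolding coring_tensor_bimodule[symmetric] coring_tens_bimodule[symmetric]
  by (simp add: entwining_coring_def Let_def)

lemma cor_counit_eq: "cor_counit X = id_counit"
  by (simp add: entwining_coring_def Let_def id_counit_def fun_eq_iff)

lemma cor_comult_eta: "m \<in> carrier M \<Longrightarrow> cor_comult X m = eta (id_comult m)"
  unfolding cor_comult_eq
  by (rule AC.ktensor_lift_unique[OF Y_abelian_group add_hom_comp[OF id_comult_add_hom eta_add_hom]])
     (simp_all add: id_comult_ac eta_acc comult_closed)

lemma cor_comult_add_hom: "add_hom M Y (cor_comult X)"
  using add_hom_comp[OF id_comult_add_hom eta_add_hom] by (simp add: add_hom_def cor_comult_eta)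

lemma cor_comult_ac:
  "\<lbrakk>a \<in> carrier A; c \<in> carrier C\<rbrakk> \<Longrightarrow> cor_comult X (ac a c) = eta1 a (comult C c)"
  by (simp add: cor_comult_eta AC.ktens_closed id_comult_ac eta_acc comult_closed)

lemma eta1_smult:
  assumes a: "a \<in> carrier A" and b: "b \<in> carrier A" and u: "u \<in> carrier D"
  shows "eta1 (a \<otimes>\<^bsub>A\<^esub> b) u = a \<odot>\<^bsub>Y\<^esub> eta1 b u"
  by (rule CC.ktensor_eqI[OF Y_abelian_group eta1_add_hom
        add_hom_comp[OF eta1_add_hom[OF b] Y_smult_add_hom[OF a]] _ u])
     (use a b in \<open>simp_all add: eta1_cc Y_smult_ct AC.ktens_closed lm_ac\<close>)

text \<open>The element \<open>a\<close> only meets the A-factor, which \<Delta> leaves alone. Right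
  linearity is of a different nature, since there \<psi> moves \<open>a\<close> past C.\<close>

lemma cor_comult_lm:
  assumes a: "a \<in> carrier A" and m: "m \<in> carrier M"
  shows "cor_comult X (lm a m) = a \<odot>\<^bsub>Y\<^esub> cor_comult X m"
  by (rule AC.ktensor_eqI[OF Y_abelian_group add_hom_comp[OF lm_add_hom[OF a] cor_comult_add_hom]
        add_hom_comp[OF cor_comult_add_hom Y_smult_add_hom[OF a]] _ m])
     (use a in \<open>simp_all add: lm_ac cor_comult_ac eta1_smult comult_closed\<close>)

text \<open>
  Curried form of \<open>theta\<close>. For \<open>y = \<rho> 1\<close> this is \<open>\<rho> \<otimes> I\<close>, so that coassociativity of \<open>\<rho>\<close> reads
  \<open>id_comult (\<rho> a) = rcoact y (\<rho> a)\<close>.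
\<close>

definition rcoact :: "('a \<times> 'c \<Rightarrow>\<^sub>0 int) set \<Rightarrow> ('a \<times> 'c \<Rightarrow>\<^sub>0 int) set \<Rightarrow>
    ('a \<times> ('c \<times> 'c \<Rightarrow>\<^sub>0 int) set \<Rightarrow>\<^sub>0 int) set" where
  "rcoact y z = tensor_lift W (\<lambda>b c. append_right (right_mult y b) c) z"

lemma rcoact_balanced_inner:
  assumes "y \<in> carrier M"
  shows "kbalanced k A C W (\<lambda>b c. append_right (right_mult y b) c)"
  using assms append_right_kbalanced
  by (intro balancedI biadd_comp[OF append_right_biadd biadd_right[OF right_mult_biadd] add_hom_ident])
     (auto simp: balanced_def right_mult_smult_right right_mult_closed)

lemma rcoact_ac:
  "\<lbrakk>y \<in> carrier M; b \<in> carrier A; c \<in> carrier C\<rbrakk> \<Longrightarrow> rcoact y (ac b c) = append_right (right_mult y b) c"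
  unfolding rcoact_def by (rule AC.ktensor_lift_ktens[OF ab_groups(5) rcoact_balanced_inner])

lemma rcoact_biadd: "biadd M M W rcoact"
proof -
  have "biadd M M W (\<lambda>z y. rcoact y z)"
    unfolding rcoact_def
    by (rule AC.ktensor_lift_biadd[OF ab_groups(5,3) rcoact_balanced_inner], assumption)
       (rule add_hom_comp[OF biadd_left[OF right_mult_biadd] biadd_left[OF append_right_biadd]])
  then show ?thesis by (rule biadd_flip)
qed

text \<open>For z = b \<otimes> c this is y (a b) = (y a) b, associativity of the right action.
  Hence \<open>rcoact\<close> descends to the tensor square over \<open>A\<close>.\<close>

lemma rcoact_balanced: "balanced A X (rsmult X) X (smult X) W rcoact"
proof (rule balancedI)
  fix y a z assume y: "y \<in> carrier X" and a: "a \<in> carrier A" and z: "z \<in> carrier X"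
  then have y': "y \<in> carrier M" "right_mult y a \<in> carrier M" and z': "z \<in> carrier M"
    by (simp_all add: right_mult_closed)
  have "rcoact (right_mult y a) z = rcoact y (lm a z)"
    by (rule AC.ktensor_eqI[OF ab_groups(5) biadd_right[OF rcoact_biadd y'(2)]
          add_hom_comp[OF lm_add_hom[OF a] biadd_right[OF rcoact_biadd y'(1)]] _ z'])
       (use y' a in \<open>simp add: rcoact_ac lm_ac right_mult_assoc\<close>)
  then show "rcoact (rsmult X y a) z = rcoact y (a \<odot>\<^bsub>X\<^esub> z)" by simp
qed (simp add: rcoact_biadd)

text \<open>For z = b \<otimes> c, \<open>eta\<close> produces y b \<otimes> (1 \<otimes> c), and
  moving b across the tensor sign gives y \<otimes> (b \<otimes> c). This turns coassociativity of a
  coaction into a formula for \<Delta>.\<close>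

lemma eta_rcoact:
  assumes y: "y \<in> carrier M" and z: "z \<in> carrier M"
  shows "eta (rcoact y z) = ct y z"
  by (rule AC.ktensor_eqI[OF Y_abelian_group add_hom_comp[OF biadd_right[OF rcoact_biadd y] eta_add_hom]
        biadd_right[OF ct_biadd y] _ z])
     (use y in \<open>simp add: rcoact_ac eta_append_right right_mult_closed ct_swap AC.ktens_closed lm_ac\<close>)

text \<open>The way back from the tensor square: (a \<otimes> c) \<otimes> (b \<otimes> c') goes to
  a \<psi>(c \<otimes> b) \<otimes> c'.\<close>

definition theta where "theta = tensor_lift W rcoact"

lemma theta_add_hom: "add_hom Y W theta"
  unfolding theta_def by (rule Y_lift_add_hom[OF ab_groups(5) rcoact_balanced])

lemma theta_ct: "\<lbrakk>y \<in> carrier M; z \<in> carrier M\<rbrakk> \<Longrightarrow> theta (ct y z) = rcoact y z"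
  unfolding theta_def by (rule X.ctensor_lift_ctens[OF ab_groups(5) rcoact_balanced]) simp_all

text \<open>The second factor made by \<open>eta1\<close> is 1 \<otimes> c', so \<open>theta\<close>
  only multiplies by 1 on the right, which is trivial by the unit axiom for \<psi>.\<close>

lemma theta_eta1:
  assumes a: "a \<in> carrier A" and u: "u \<in> carrier D"
  shows "theta (eta1 a u) = acc a u"
  by (rule CC.ktensor_eqI[OF ab_groups(5) add_hom_comp[OF eta1_add_hom[OF a] theta_add_hom]
        biadd_right[OF acc_biadd a] _ u])
     (use a in \<open>simp add: eta1_cc theta_ct AC.ktens_closed rcoact_ac right_mult_one append_right_ac\<close>)

lemma theta_cor_comult:
  assumes m: "m \<in> carrier M"
  shows "theta (cor_comult X m) = id_comult m"
  by (rule AC.ktensor_eqI[OF ab_groups(5) add_hom_comp[OF cor_comult_add_hom theta_add_hom]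
        id_comult_add_hom _ m])
     (simp add: cor_comult_ac theta_eta1 comult_closed id_comult_ac)

end

lemma entwining_pre_entwining:
  assumes "entwining_structure k A C \<psi>"
  shows "pre_entwining k A C \<psi>"
proof -
  interpret E: entwining_structure k A C \<psi> by (rule assms)
  show ?thesis
  proof (intro pre_entwining.intro algebra_coalgebra.intro pre_entwining_axioms.intro)
    show "k_algebra k A" "coalgebra k C" by unfold_locales
  qed (simp_all add: E.entwining_linear E.entwining_mult E.entwining_one left_mult_tensor_def)
qed

section \<open>From Galois corings to Galois extensions\<close>

text \<open>
  \<open>A \<otimes>\<^sub>B A\<close> depends on \<open>B\<close> only through its image in \<open>A\<close>, as an equality of sets of cosets: the
  generating relations coincide.
\<close>

lemma ext_balance_rels_image:
  "{frag_of (m \<otimes>\<^bsub>A\<^esub> j s, n) - frag_of (m, j s \<otimes>\<^bsub>A\<^esub> n) | m s n.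
      m \<in> carrier A \<and> s \<in> carrier B \<and> n \<in> carrier A} =
   (\<lambda>(m, v, n). frag_of (m \<otimes>\<^bsub>A\<^esub> v, n) - frag_of (m, v \<otimes>\<^bsub>A\<^esub> n)) `
      (carrier A \<times> j ` carrier B \<times> carrier A)"
  by (auto simp: image_iff) blast

lemma ext_tensor_image_cong:
  assumes "j ` carrier B = j' ` carrier B'"
  shows "ext_tensor B A j = ext_tensor B' A j'" and "ext_tens B A j = ext_tens B' A j'"
proof -
  have "tensor_rels B A (\<lambda>a b. a \<otimes>\<^bsub>A\<^esub> j b) A (\<lambda>b a. j b \<otimes>\<^bsub>A\<^esub> a) =
        tensor_rels B' A (\<lambda>a b. a \<otimes>\<^bsub>A\<^esub> j' b) A (\<lambda>b a. j' b \<otimes>\<^bsub>A\<^esub> a)"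
    unfolding tensor_rels_def ext_balance_rels_image assms ..
  then show "ext_tensor B A j = ext_tensor B' A j'" "ext_tens B A j = ext_tens B' A j'"
    by (simp_all add: ext_tensor_def ext_tens_def tensor_def tens_def tensor_kernel_def fun_eq_iff)
qed

context pre_entwining
begin

lemma grouplike_coaction:
  assumes cor: "coring A X" and x: "grouplike A X x"
  shows "right_comodule k C A (right_mult x)"
proof -
  interpret cor: coring A X by (rule cor)
  have x': "x \<in> carrier M" "cor_comult X x = ct x x" "id_counit x = \<one>\<^bsub>A\<^esub>"
    using x by (simp_all add: grouplike_def cor_counit_eq)
  show ?thesis
  proof (intro right_comodule.intro right_comodule_axioms.intro)
    show "coalgebra k C" by unfold_locales
    show "module k A" by unfold_locales
    show "k_linear k A M (right_mult x)"
      using x' by (simp add: k_linear_iff biadd_right[OF right_mult_biadd] right_mult_smult_right)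
  next
    fix m assume m: "m \<in> carrier A"
    have "id_comult (right_mult x m) = theta (cor_comult X (right_mult x m))"
      using x' m by (simp add: theta_cor_comult right_mult_closed)
    also have "cor_comult X (right_mult x m) = ct x (right_mult x m)"
      using cor.cor_comult_right[OF m, of x] x' m by (simp add: Y_rsmult_ct)
    also have "theta \<dots> = rcoact x (right_mult x m)"
      using x' m by (simp add: theta_ct right_mult_closed)
    finally show "tensor_lift W (\<lambda>m0 c. tensor_lift W (\<lambda>m00 c'. acc m00 (cc c' c)) (right_mult x m0)) (right_mult x m) =
        tensor_lift W (\<lambda>m0 c. acc m0 (comult C c)) (right_mult x m)"
      by (simp add: rcoact_def append_right_def id_comult_def)
    \<comment> \<open>Right linearity of the counit: \<epsilon>(x m) = \<epsilon>(x) m = m.\<close>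
    show "tensor_lift A (\<lambda>m0 c. counit C c \<odot>\<^bsub>A\<^esub> m0) (right_mult x m) = m"
      using cor.cor_counit_right[OF m, of x] x' m by (simp add: cor_counit_eq flip: id_counit_def)
  qed
qed

lemma galois_coring_imp_galois_extension:
  assumes "grouplike A X x" and coinv: "coinvariants A X x = i ` carrier B"
    and gal: "galois_coring A X x"
  shows "galois_extension k C B A i"
  unfolding galois_extension_def
proof (intro exI conjI)
  have x: "x \<in> carrier M" and cor: "coring A X"
    using assms by (simp_all add: grouplike_def galois_coring_def)
  show "right_comodule k C A (right_mult x)"
    by (rule grouplike_coaction[OF cor assms(1)])
  let ?B = "A\<lparr>carrier := coinvariants A X x\<rparr>"
  have "(\<lambda>b. b) ` carrier ?B = i ` carrier B"
    using coinv by simp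
  note eq = ext_tensor_image_cong[OF this]
  obtain can where can: "can \<in> iso (add_monoid (ext_tensor ?B A (\<lambda>b. b))) (add_monoid X)"
    and can_tens: "\<And>a a'. \<lbrakk>a \<in> carrier A; a' \<in> carrier A\<rbrakk> \<Longrightarrow>
      can (ext_tens ?B A (\<lambda>b. b) a a') = right_mult (lm a x) a'"
    using gal by (auto simp: galois_coring_def Let_def)
  show "\<exists>can \<in> iso (add_monoid (ext_tensor B A i)) (add_monoid M).
      \<forall>a \<in> carrier A. \<forall>a' \<in> carrier A. can (ext_tens B A i a a') = lm a (right_mult x a')"
  proof (intro bexI ballI)
    show "can \<in> iso (add_monoid (ext_tensor B A i)) (add_monoid M)"
      using can by (simp add: iso_def hom_def eq)
  qed (use can_tens x in \<open>simp add: eq[symmetric] right_mult_lm\<close>)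
  \<comment> \<open>With \<rho> a = x a and x 1 = x, the condition \<rho> a = a \<rho>(1) reads x a
    = a x.\<close>
  show "i ` carrier B = {a \<in> carrier A. right_mult x a = lm a (right_mult x \<one>\<^bsub>A\<^esub>)}"
    unfolding coinv[symmetric] using x by (auto simp: coinvariants_def right_mult_one)
qed

end

section \<open>From Galois extensions to Galois corings\<close>

locale galois_coaction = algebra_coalgebra k A C + coaction: right_comodule k C A \<rho>
  for k :: "('k, 'p) ring_scheme" and A :: "('k, 'a, 'q) module_scheme"
    and C :: "('k, 'c, 't) coalgebra_scheme" and \<rho> :: "'a \<Rightarrow> ('a \<times> 'c \<Rightarrow>\<^sub>0 int) set" +
  fixes B :: "('b, 's) ring_scheme" and i :: "'b \<Rightarrow> 'a" and can
  assumes i_closed: "b \<in> carrier B \<Longrightarrow> i b \<in> carrier A"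
    and can_iso: "can \<in> iso (add_monoid (ext_tensor B A i)) (add_monoid (ktensor k A C))"
    and can_ext_tens: "\<lbrakk>a \<in> carrier A; a' \<in> carrier A\<rbrakk> \<Longrightarrow>
      can (ext_tens B A i a a') = left_mult_tensor k A C a (\<rho> a')"
begin

abbreviation "E \<equiv> ext_tensor B A i"
abbreviation "et \<equiv> ext_tens B A i"

sublocale E: tensor_product B A "\<lambda>a b. a \<otimes>\<^bsub>A\<^esub> i b" A "\<lambda>b a. i b \<otimes>\<^bsub>A\<^esub> a"
  by (intro tensor_product.intro ab_groups) (simp_all add: i_closed)

lemma E_abelian_group: "abelian_group E"
  using E.tensor_abelian_group by (simp add: ext_tensor_def)

lemmas et_balanced = E.tens_balanced[folded ext_tensor_def ext_tens_def]
lemmas E_eqI = E.add_hom_eqI[folded ext_tensor_def ext_tens_def]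
lemmas E_lift_add_hom = E.tensor_lift_add_hom[folded ext_tensor_def ext_tens_def]
lemmas E_lift_et = E.tensor_lift_tens[folded ext_tensor_def ext_tens_def]

lemma et_closed: "\<lbrakk>a \<in> carrier A; a' \<in> carrier A\<rbrakk> \<Longrightarrow> et a a' \<in> carrier E"
  by (rule biadd_closed[OF balanced_biadd[OF et_balanced]])

lemma can_add_hom: "add_hom E M can"
  using can_iso by (simp add: iso_def add_hom_iff_hom)

lemma can_bij: "bij_betw can (carrier E) (carrier M)"
  using can_iso by (simp add: iso_def)

section \<open>Transport of the right multiplication along the canonical map\<close>

definition cinv where "cinv = inv_into (carrier E) can"

lemma cinv_can: "e \<in> carrier E \<Longrightarrow> cinv (can e) = e"
  unfolding cinv_def by (rule bij_betw_inv_into_left[OF can_bij])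

lemma can_cinv: "m \<in> carrier M \<Longrightarrow> can (cinv m) = m"
  unfolding cinv_def by (rule bij_betw_inv_into_right[OF can_bij])

lemma cinv_closed: "m \<in> carrier M \<Longrightarrow> cinv m \<in> carrier E"
  unfolding cinv_def using bij_betw_inv_into[OF can_bij] by (auto simp: bij_betw_def)

lemma cinv_add_hom: "add_hom M E cinv"
proof (rule add_homI)
  interpret E: abelian_group E by (rule E_abelian_group)
  fix x y assume xy: "x \<in> carrier M" "y \<in> carrier M"
  then have "x \<oplus>\<^bsub>M\<^esub> y = can (cinv x \<oplus>\<^bsub>E\<^esub> cinv y)"
    by (simp add: add_hom_add[OF can_add_hom] cinv_closed can_cinv)
  then show "cinv (x \<oplus>\<^bsub>M\<^esub> y) = cinv x \<oplus>\<^bsub>E\<^esub> cinv y"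
    using xy by (simp add: cinv_can cinv_closed)
qed (rule cinv_closed)

definition rx where "rx a = tensor_lift E (\<lambda>a1 a2. et a1 (a2 \<otimes>\<^bsub>A\<^esub> a))"

text \<open>Right multiplication commutes with the left action of \<open>B\<close> on the second
  factor, by associativity in \<open>A\<close>.\<close>

lemma rx_balanced:
  assumes "a \<in> carrier A"
  shows "balanced B A (\<lambda>a b. a \<otimes>\<^bsub>A\<^esub> i b) A (\<lambda>b a. i b \<otimes>\<^bsub>A\<^esub> a) E (\<lambda>a1 a2. et a1 (a2 \<otimes>\<^bsub>A\<^esub> a))"
  using assms et_balanced
  by (intro balancedI biadd_comp[OF balanced_biadd[OF et_balanced] add_hom_ident biadd_left[OF A_mult_biadd]])
     (simp_all add: balanced_def i_closed A.m_assoc)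

lemma rx_add_hom: "a \<in> carrier A \<Longrightarrow> add_hom E E (rx a)"
  unfolding rx_def by (rule E_lift_add_hom[OF E_abelian_group rx_balanced])

lemma rx_et:
  "\<lbrakk>a \<in> carrier A; b \<in> carrier A; b' \<in> carrier A\<rbrakk> \<Longrightarrow> rx a (et b b') = et b (b' \<otimes>\<^bsub>A\<^esub> a)"
  unfolding rx_def by (rule E_lift_et[OF E_abelian_group rx_balanced])

text \<open>The right multiplication of \<open>A \<otimes>\<^sub>B A\<close>, transported along \<open>can\<close>.\<close>

definition act where "act a m = can (rx a (cinv m))"

lemma rho_k_linear: "k_linear k A M \<rho>"
  by (rule coaction.coaction_linear)

lemma rho_add_hom: "add_hom A M \<rho>"
  using rho_k_linear by (simp add: k_linear_iff)

lemma rho_closed: "a \<in> carrier A \<Longrightarrow> \<rho> a \<in> carrier M"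
  by (rule add_hom_closed[OF rho_add_hom])

lemma rho_smult: "\<lbrakk>s \<in> carrier k; a \<in> carrier A\<rbrakk> \<Longrightarrow> \<rho> (s \<odot>\<^bsub>A\<^esub> a) = s \<odot>\<^bsub>M\<^esub> \<rho> a"
  using rho_k_linear by (simp add: k_linear_iff)

text \<open>
  Surjectivity of \<open>can\<close>: to compare additive maps on \<open>A \<otimes> C\<close> it suffices to look at the elements
  \<open>a \<rho>(a')\<close>, on which the transported action is simply \<open>a \<rho>(a') b = a \<rho>(a' b)\<close>.
\<close>

lemma M_eqI:
  assumes H: "abelian_group H" and f: "add_hom M H f" and g: "add_hom M H g"
    and eq: "\<And>a a'. \<lbrakk>a \<in> carrier A; a' \<in> carrier A\<rbrakk> \<Longrightarrow> f (lm a (\<rho> a')) = g (lm a (\<rho> a'))"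
    and m: "m \<in> carrier M"
  shows "f m = g m"
proof -
  have "f (can (cinv m)) = g (can (cinv m))"
    by (rule E_eqI[OF H add_hom_comp[OF can_add_hom f] add_hom_comp[OF can_add_hom g] _ cinv_closed[OF m]])
       (simp add: can_ext_tens eq)
  with m show ?thesis by (simp add: can_cinv)
qed

lemma act_add_hom: "a \<in> carrier A \<Longrightarrow> add_hom M M (act a)"
  unfolding act_def[abs_def]
  by (intro add_hom_comp[OF add_hom_comp[OF cinv_add_hom rx_add_hom] can_add_hom])

lemma act_closed: "\<lbrakk>a \<in> carrier A; m \<in> carrier M\<rbrakk> \<Longrightarrow> act a m \<in> carrier M"
  by (rule add_hom_closed[OF act_add_hom])

lemma act_rho:
  assumes "a \<in> carrier A" "b \<in> carrier A" "b' \<in> carrier A"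
  shows "act a (lm b (\<rho> b')) = lm b (\<rho> (b' \<otimes>\<^bsub>A\<^esub> a))"
  using assms by (simp add: act_def rx_et cinv_can et_closed flip: can_ext_tens)

lemma act_lm:
  assumes a: "a \<in> carrier A" and b: "b \<in> carrier A" and m: "m \<in> carrier M"
  shows "act a (lm b m) = lm b (act a m)"
  by (rule M_eqI[OF ab_groups(3) add_hom_comp[OF lm_add_hom[OF b] act_add_hom[OF a]]
        add_hom_comp[OF act_add_hom[OF a] lm_add_hom[OF b]] _ m])
     (use a b in \<open>simp add: act_rho rho_closed flip: lm_assoc\<close>)

lemma act_one: "m \<in> carrier M \<Longrightarrow> act \<one>\<^bsub>A\<^esub> m = m"
  by (rule M_eqI[OF ab_groups(3) act_add_hom add_hom_ident]) (simp_all add: act_rho)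

lemma act_mult:
  assumes a: "a \<in> carrier A" and b: "b \<in> carrier A" and m: "m \<in> carrier M"
  shows "act (a \<otimes>\<^bsub>A\<^esub> b) m = act b (act a m)"
  by (rule M_eqI[OF ab_groups(3) act_add_hom add_hom_comp[OF act_add_hom[OF a] act_add_hom[OF b]] _ m])
     (use a b in \<open>simp_all add: act_rho A.m_assoc\<close>)

lemma act_biadd: "biadd A M M act"
  unfolding biadd_def
proof (intro conjI ballI act_add_hom)
  fix m assume m: "m \<in> carrier M"
  show "add_hom A M (\<lambda>a. act a m)"
  proof (rule add_homI)
    fix a b assume ab: "a \<in> carrier A" "b \<in> carrier A"
    have sum: "add_hom M M (\<lambda>m. act a m \<oplus>\<^bsub>M\<^esub> act b m)"
      using ab by (auto intro!: add_homI simp: act_closed add_hom_add[OF act_add_hom] M.a_ac)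
    show "act (a \<oplus>\<^bsub>A\<^esub> b) m = act a m \<oplus>\<^bsub>M\<^esub> act b m"
      by (rule M_eqI[OF ab_groups(3) act_add_hom sum _ m])
         (use ab in \<open>simp_all add: act_rho A.r_distr add_hom_add[OF rho_add_hom] rho_closed
            add_hom_add[OF lm_add_hom]\<close>)
  qed (simp add: act_closed m)
qed

lemma act_smult_left:
  assumes s: "s \<in> carrier k" and a: "a \<in> carrier A" and m: "m \<in> carrier M"
  shows "act (s \<odot>\<^bsub>A\<^esub> a) m = s \<odot>\<^bsub>M\<^esub> act a m"
  by (rule M_eqI[OF ab_groups(3) act_add_hom add_hom_comp[OF act_add_hom[OF a] AC.smult_add_hom[OF s]] _ m])
     (use s a in \<open>simp_all add: act_rho A.smult_mult_right rho_smult lm_smult_right rho_closed\<close>)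

text \<open>A scalar acts as left multiplication by s 1, so this is a case of
  \<open>act_lm\<close>.\<close>

lemma act_smult_right:
  assumes s: "s \<in> carrier k" and a: "a \<in> carrier A" and m: "m \<in> carrier M"
  shows "act a (s \<odot>\<^bsub>M\<^esub> m) = s \<odot>\<^bsub>M\<^esub> act a m"
  using act_lm[OF a _ m, of "s \<odot>\<^bsub>A\<^esub> \<one>\<^bsub>A\<^esub>"] assms
  by (simp add: lm_smult_left lm_one act_closed)

section \<open>The entwining map of a Galois coaction\<close>

definition psi where "psi = tensor_lift M (\<lambda>c a. act a (ac \<one>\<^bsub>A\<^esub> c))"

lemma psi_balanced: "kbalanced k C A M (\<lambda>c a. act a (ac \<one>\<^bsub>A\<^esub> c))"
  by (intro balancedI biadd_comp[OF biadd_flip[OF act_biadd] biadd_right[OF ac_biadd] add_hom_ident])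
     (simp_all add: act_smult_left AC.ktens_closed act_smult_right
       flip: AC.ktens_smult_swap AC.smult_ktens)

lemma psi_ca: "\<lbrakk>c \<in> carrier C; a \<in> carrier A\<rbrakk> \<Longrightarrow> psi (ca c a) = act a (ac \<one>\<^bsub>A\<^esub> c)"
  unfolding psi_def by (rule CA.ktensor_lift_ktens[OF ab_groups(3) psi_balanced])

text \<open>Left linearity of \<open>act\<close> gives a \<psi>(c \<otimes> b) = (a \<otimes> c) b,
  so the right action defined through \<open>psi\<close> is the transported one. The
  multiplicativity and unit axioms of \<open>psi\<close> thereby reduce to \<open>act_mult\<close>
  and \<open>act_one\<close>.\<close>

lemma psi_lift_act:
  assumes b: "b \<in> carrier A" and m: "m \<in> carrier M"
  shows "tensor_lift M (\<lambda>a c. lm a (psi (ca c b))) m = act b m"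
  by (rule AC.ktensor_lift_unique[OF ab_groups(3) act_add_hom[OF b] _ m])
     (use b in \<open>simp add: psi_ca AC.ktens_closed lm_ac flip: act_lm\<close>)

sublocale PE: pre_entwining k A C psi
proof
  show "k_linear k (ktensor k C A) M psi"
    unfolding psi_def
    by (rule CA.ktensor_lift_k_linear[OF AC.ktensor_module psi_balanced])
       (simp add: AC.ktens_closed act_smult_right flip: AC.ktens_smult_swap AC.smult_ktens)
qed (simp_all add: psi_lift_act psi_ca act_mult act_one act_closed AC.ktens_closed)

lemma right_mult_act: "\<lbrakk>m \<in> carrier M; a \<in> carrier A\<rbrakk> \<Longrightarrow> PE.right_mult m a = act a m"
  by (simp add: PE.right_mult_def psi_lift_act)

section \<open>Sweedler's formulas for \<Delta> and \<epsilon>, and the remaining entwining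
  axioms\<close>

definition x where "x = \<rho> \<one>\<^bsub>A\<^esub>"

lemma x_closed: "x \<in> carrier M"
  by (simp add: x_def rho_closed)

lemma right_mult_x: "a \<in> carrier A \<Longrightarrow> PE.right_mult x a = \<rho> a"
  using act_rho[of a "\<one>\<^bsub>A\<^esub>" "\<one>\<^bsub>A\<^esub>"] by (simp add: right_mult_act x_closed) (simp add: x_def rho_closed lm_one)

lemma right_mult_rho: "\<lbrakk>a \<in> carrier A; b \<in> carrier A; b' \<in> carrier A\<rbrakk> \<Longrightarrow>
   PE.right_mult (lm b (\<rho> b')) a = lm b (\<rho> (b' \<otimes>\<^bsub>A\<^esub> a))"
  by (simp add: right_mult_act act_rho lm_closed rho_closed)

lemma right_mult_rho': "\<lbrakk>a \<in> carrier A; b \<in> carrier A\<rbrakk> \<Longrightarrow> PE.right_mult (\<rho> b) a = \<rho> (b \<otimes>\<^bsub>A\<^esub> a)"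
  using right_mult_rho[of a "\<one>\<^bsub>A\<^esub>" b] by (simp add: rho_closed lm_one)

lemma id_comult_rho:
  assumes a: "a \<in> carrier A"
  shows "id_comult (\<rho> a) = PE.rcoact x (\<rho> a)"
proof -
  have "id_comult (\<rho> a) = tensor_lift W (\<lambda>m0 c. append_right (\<rho> m0) c) (\<rho> a)"
    using coaction.coaction_coassoc[OF a] by (simp add: id_comult_def append_right_def)
  \<comment> \<open>\<rho> m0 equals x m0 only for \<open>m0\<close> in the carrier, so the
    integrand cannot simply be rewritten under the lift; uniqueness of the lift is used
    instead.\<close>
  also have "\<dots> = PE.rcoact x (\<rho> a)"
    by (rule AC.ktensor_lift_unique[OF ab_groups(5) biadd_right[OF PE.rcoact_biadd x_closed] _ rho_closed[OF a]])
       (simp add: PE.rcoact_ac x_closed right_mult_x)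
  finally show ?thesis .
qed

text \<open>Coassociativity of \<rho>, carried over by \<open>eta\<close>, gives \<Delta>(\<rho> a)
  = x \<otimes> \<rho> a. Left linearity then supplies the factor b.\<close>

lemma cor_comult_rho:
  assumes a: "a \<in> carrier A" and b: "b \<in> carrier A"
  shows "cor_comult PE.X (lm b (\<rho> a)) = PE.ct (lm b x) (\<rho> a)"
  using assms
  by (simp add: PE.cor_comult_lm rho_closed PE.cor_comult_eta id_comult_rho PE.eta_rcoact x_closed PE.Y_smult_ct)

text \<open>On a generator b \<rho>(a') both sides are b x \<otimes> \<rho>(a' a).\<close>

lemma cor_comult_rm:
  assumes a: "a \<in> carrier A" and m: "m \<in> carrier M"
  shows "cor_comult PE.X (PE.right_mult m a) = coring_tensor_rsmult A PE.X (cor_comult PE.X m) a"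
  by (rule M_eqI[OF PE.Y_abelian_group
        add_hom_comp[OF biadd_left[OF PE.right_mult_biadd a] PE.cor_comult_add_hom]
        add_hom_comp[OF PE.cor_comult_add_hom PE.Y_rsmult_add_hom[OF a]] _ m])
     (use a in \<open>simp add: right_mult_rho right_mult_rho' cor_comult_rho PE.Y_rsmult_ct lm_closed x_closed rho_closed\<close>)

lemma id_counit_rho: "a \<in> carrier A \<Longrightarrow> id_counit (\<rho> a) = a"
  using coaction.coaction_counit[of a] by (simp add: id_counit_def)

lemma id_counit_rm:
  assumes a: "a \<in> carrier A" and m: "m \<in> carrier M"
  shows "id_counit (PE.right_mult m a) = id_counit m \<otimes>\<^bsub>A\<^esub> a"
  by (rule M_eqI[OF ab_groups(1) add_hom_comp[OF biadd_left[OF PE.right_mult_biadd a] id_counit_add_hom]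
        add_hom_comp[OF id_counit_add_hom biadd_left[OF A_mult_biadd a]] _ m])
     (use a in \<open>simp add: right_mult_rho id_counit_lm rho_closed id_counit_rho A.m_assoc\<close>)

lemma entwining: "entwining_structure k A C psi"
proof (intro entwining_structure.intro entwining_structure_axioms.intro)
  show "k_algebra k A" "coalgebra k C" by unfold_locales
  show "k_linear k (ktensor k C A) M psi" by (rule PE.psi_linear)
next
  fix a b c assume "a \<in> carrier A" "b \<in> carrier A" "c \<in> carrier C"
  then show "psi (ca c (a \<otimes>\<^bsub>A\<^esub> b)) =
      tensor_lift M (\<lambda>a' c'. tensor_lift M (\<lambda>b'. ac (a' \<otimes>\<^bsub>A\<^esub> b')) (psi (ca c' b))) (psi (ca c a))"
    using PE.psi_mult by (simp add: left_mult_tensor_def)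
next
  fix c assume "c \<in> carrier C"
  then show "psi (ca c \<one>\<^bsub>A\<^esub>) = ac \<one>\<^bsub>A\<^esub> c" by (rule PE.psi_one)
next
  fix a c assume a: "a \<in> carrier A" and c: "c \<in> carrier C"
  have right_mult1: "PE.right_mult (ac \<one>\<^bsub>A\<^esub> c') a' = psi (ca c' a')" if "c' \<in> carrier C" "a' \<in> carrier A" for c' a'
    using that by (simp add: PE.right_mult_ac lm_one PE.psi_closed)
  \<comment> \<open>The innermost part of the axiom applies \<psi> to c1 \<otimes> a', which is
    right multiplication of 1 \<otimes> c1 by a'; hence the lift is \<open>rcoact\<close> at 1
    \<otimes> c1.\<close>
  have inner: "tensor_lift W (\<lambda>a' c2'. append_right (psi (ca c1 a')) c2') z = PE.rcoact (ac \<one>\<^bsub>A\<^esub> c1) z"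
    if "c1 \<in> carrier C" "z \<in> carrier M" for c1 z
    by (rule AC.ktensor_lift_unique[OF ab_groups(5) biadd_right[OF PE.rcoact_biadd] _ that(2)])
       (use that in \<open>simp_all add: AC.ktens_closed PE.rcoact_ac right_mult1\<close>)
  \<comment> \<open>For u = c1 \<otimes> c2, multiplying (1 \<otimes> c1) \<otimes> (1 \<otimes> c2)
    on the right by a gives (1 \<otimes> c1) \<otimes> \<psi>(c2 \<otimes> a), and
    \<open>theta\<close> sends this to the left-hand side. General \<open>u\<close> is needed
    because \<Delta> c is not a pure tensor.\<close>
  have outer: "tensor_lift W (\<lambda>c1 c2. tensor_lift W (\<lambda>a' c2'. append_right (psi (ca c1 a')) c2') (psi (ca c2 a))) u
      = PE.theta (coring_tensor_rsmult A PE.X (PE.eta1 \<one>\<^bsub>A\<^esub> u) a)" if "u \<in> carrier D" for u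
    by (rule CC.ktensor_lift_unique[OF ab_groups(5) add_hom_comp[OF add_hom_comp[OF PE.eta1_add_hom
            PE.Y_rsmult_add_hom[OF a]] PE.theta_add_hom] _ that])
       (use a in \<open>simp_all add: PE.eta1_cc PE.Y_rsmult_ct AC.ktens_closed PE.theta_ct inner
          PE.psi_closed right_mult1\<close>)
  have "id_comult (psi (ca c a)) = PE.theta (cor_comult PE.X (PE.right_mult (ac \<one>\<^bsub>A\<^esub> c) a))"
    using a c by (simp add: right_mult1 PE.theta_cor_comult PE.psi_closed)
  also have "\<dots> = PE.theta (coring_tensor_rsmult A PE.X (PE.eta1 \<one>\<^bsub>A\<^esub> (comult C c)) a)"
    using a c by (simp add: cor_comult_rm PE.cor_comult_ac AC.ktens_closed del: PE.X_simps)
  also note outer[OF comult_closed[OF c], symmetric]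
  finally show "tensor_lift W (\<lambda>a' c'. acc a' (comult C c')) (psi (ca c a)) =
      tensor_lift W (\<lambda>c1 c2. tensor_lift W (\<lambda>a' c2'. tensor_lift W
        (\<lambda>a'' c1'. acc a'' (cc c1' c2')) (psi (ca c1 a'))) (psi (ca c2 a))) (comult C c)"
    by (simp add: id_comult_def append_right_def)
  \<comment> \<open>The counit axiom is \<epsilon>((1 \<otimes> c) a) = \<epsilon>(1 \<otimes> c)
    a.\<close>
  have "id_counit (psi (ca c a)) = counit C c \<odot>\<^bsub>A\<^esub> a"
    using a c id_counit_rm[OF a, of "ac \<one>\<^bsub>A\<^esub> c"]
    by (simp add: right_mult1 AC.ktens_closed id_counit_ac counit_closed A.smult_mult_left)
  then show "tensor_lift A (\<lambda>a' c'. counit C c' \<odot>\<^bsub>A\<^esub> a') (psi (ca c a)) = counit C c \<odot>\<^bsub>A\<^esub> a"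
    by (simp add: id_counit_def)
qed

section \<open>The coring axioms\<close>

interpretation X: bimodule A PE.X
  by (rule PE.X_bimodule)

abbreviation "Z \<equiv> coring_tensor3 A PE.X"
abbreviation "t3 \<equiv> coring_tens3 A PE.X"

lemma t3_biadd: "biadd M PE.Y Z t3"
  using balanced_biadd[OF PE.Z_balanced] by simp

lemma t3_swap:
  "\<lbrakk>y \<in> carrier M; a \<in> carrier A; u \<in> carrier PE.Y\<rbrakk> \<Longrightarrow>
   t3 (PE.right_mult y a) u = t3 y (a \<odot>\<^bsub>PE.Y\<^esub> u)"
  using PE.Z_balanced by (simp add: balanced_def)

lemma cor_comult_x_rho: "a \<in> carrier A \<Longrightarrow> cor_comult PE.X (\<rho> a) = PE.ct x (\<rho> a)"
  using cor_comult_rho[of a "\<one>\<^bsub>A\<^esub>"] by (simp add: rho_closed lm_one x_closed)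

lemma cor_comult_lm_x: "b \<in> carrier A \<Longrightarrow> cor_comult PE.X (lm b x) = PE.ct (lm b x) x"
  using cor_comult_rho[of "\<one>\<^bsub>A\<^esub>" b] by (simp flip: x_def)

lemma coassoc_inner_balanced:
  assumes z: "z \<in> carrier M"
  shows "balanced A PE.X (rsmult PE.X) PE.X (smult PE.X) Z (\<lambda>y y'. t3 y (PE.ct y' z))"
proof (rule balancedI)
  show "biadd PE.X PE.X Z (\<lambda>y y'. t3 y (PE.ct y' z))"
    using biadd_comp[OF t3_biadd add_hom_ident biadd_left[OF PE.ct_biadd z]] by simp
qed (use z in \<open>simp add: t3_swap PE.ct_closed PE.Y_smult_ct\<close>)

text \<open>Rebracketing (y \<otimes> y') \<otimes> z to y \<otimes> (y' \<otimes> z), curried in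
  z.\<close>

definition assoc_right where
  "assoc_right u z = tensor_lift Z (\<lambda>y y'. t3 y (PE.ct y' z)) u"

lemma assoc_right_ct:
  "\<lbrakk>y \<in> carrier M; y' \<in> carrier M; z \<in> carrier M\<rbrakk> \<Longrightarrow>
   assoc_right (PE.ct y y') z = t3 y (PE.ct y' z)"
  unfolding assoc_right_def
  by (rule X.ctensor_lift_ctens[OF PE.Z_abelian_group coassoc_inner_balanced]) simp_all

lemma assoc_right_biadd: "biadd PE.Y M Z assoc_right"
  unfolding assoc_right_def[abs_def]
  by (rule X.ctensor_lift_biadd[OF PE.Z_abelian_group ab_groups(3) coassoc_inner_balanced], assumption)
     (use add_hom_comp[OF biadd_right[OF PE.ct_biadd] biadd_right[OF t3_biadd]] in simp)

lemma assoc_right_swap: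
  assumes u: "u \<in> carrier PE.Y" and a: "a \<in> carrier A" and z: "z \<in> carrier M"
  shows "assoc_right (coring_tensor_rsmult A PE.X u a) z = assoc_right u (lm a z)"
  by (rule PE.Y_eqI[OF PE.Z_abelian_group
        add_hom_comp[OF PE.Y_rsmult_add_hom[OF a] biadd_left[OF assoc_right_biadd z]]
        biadd_left[OF assoc_right_biadd lm_closed[OF a z]] _ u])
     (use a z in \<open>simp_all add: PE.Y_rsmult_ct assoc_right_ct PE.right_mult_closed lm_closed PE.ct_swap\<close>)

text \<open>Well-definedness of \<Delta> \<otimes> I over \<open>A\<close> rests on right linearity
  of \<Delta>, just as that of I \<otimes> \<Delta> rests on left linearity.\<close>

lemma coassoc_left_balanced:
  "balanced A PE.X (rsmult PE.X) PE.X (smult PE.X) Z (\<lambda>y z. assoc_right (cor_comult PE.X y) z)"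
proof (rule balancedI)
  show "biadd PE.X PE.X Z (\<lambda>y z. assoc_right (cor_comult PE.X y) z)"
    using biadd_comp[OF assoc_right_biadd PE.cor_comult_add_hom add_hom_ident] by simp
qed (simp add: cor_comult_rm assoc_right_swap add_hom_closed[OF PE.cor_comult_add_hom])

lemma coassoc_right_balanced:
  "balanced A PE.X (rsmult PE.X) PE.X (smult PE.X) Z (\<lambda>y z. t3 y (cor_comult PE.X z))"
proof (rule balancedI)
  show "biadd PE.X PE.X Z (\<lambda>y z. t3 y (cor_comult PE.X z))"
    using biadd_comp[OF t3_biadd add_hom_ident PE.cor_comult_add_hom] by simp
qed (simp add: t3_swap add_hom_closed[OF PE.cor_comult_add_hom] PE.cor_comult_lm)

lemma counit_left_balanced:
  "balanced A PE.X (rsmult PE.X) PE.X (smult PE.X) PE.X (\<lambda>y z. lm (id_counit y) z)"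
proof (rule balancedI)
  show "biadd PE.X PE.X PE.X (\<lambda>y z. lm (id_counit y) z)"
    using biadd_comp[OF lm_biadd id_counit_add_hom add_hom_ident] by simp
qed (simp add: id_counit_rm lm_assoc add_hom_closed[OF id_counit_add_hom])

lemma counit_right_balanced:
  "balanced A PE.X (rsmult PE.X) PE.X (smult PE.X) PE.X (\<lambda>y z. PE.right_mult y (id_counit z))"
proof (rule balancedI)
  show "biadd PE.X PE.X PE.X (\<lambda>y z. PE.right_mult y (id_counit z))"
    using biadd_comp[OF PE.right_mult_biadd add_hom_ident id_counit_add_hom] by simp
qed (simp add: id_counit_lm add_hom_closed[OF id_counit_add_hom] flip: PE.right_mult_assoc)

lemma coring: "coring A PE.X"
proof (intro coring.intro coring_axioms.intro)
  show "ring A" by (rule A.ring_axioms)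
  show "abelian_group PE.X" by (rule PE.X_abelian_group)
  show "cor_comult PE.X \<in> hom (add_monoid PE.X) (add_monoid PE.Y)"
    unfolding add_hom_iff_hom[symmetric] by (simp add: PE.cor_comult_add_hom)
  show "cor_counit PE.X \<in> hom (add_monoid PE.X) (add_monoid A)"
    unfolding add_hom_iff_hom[symmetric] by (simp add: PE.cor_counit_eq id_counit_add_hom)
next
  fix m assume "m \<in> carrier PE.X"
  then have m: "m \<in> carrier M" by simp
  have xa: "lm a x \<in> carrier PE.X" "\<rho> a \<in> carrier PE.X" "x \<in> carrier PE.X" if "a \<in> carrier A" for a
    using that by (simp_all add: lm_closed x_closed rho_closed)
  note lift_left = X.ctensor_lift_add_hom[OF PE.Z_abelian_group coassoc_left_balanced]
    X.ctensor_lift_ctens[OF PE.Z_abelian_group coassoc_left_balanced]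
  note lift_right = X.ctensor_lift_add_hom[OF PE.Z_abelian_group coassoc_right_balanced]
    X.ctensor_lift_ctens[OF PE.Z_abelian_group coassoc_right_balanced]
  \<comment> \<open>On b \<rho>(a), where \<Delta> gives b x \<otimes> \<rho> a, both sides become b
    x \<otimes> (x \<otimes> \<rho> a).\<close>
  have "tensor_lift Z (\<lambda>y z. assoc_right (cor_comult PE.X y) z) (cor_comult PE.X m) =
        tensor_lift Z (\<lambda>y z. t3 y (cor_comult PE.X z)) (cor_comult PE.X m)"
    by (rule M_eqI[OF PE.Z_abelian_group add_hom_comp[OF PE.cor_comult_add_hom lift_left(1)]
          add_hom_comp[OF PE.cor_comult_add_hom lift_right(1)] _ m])
       (simp add: cor_comult_rho lift_left(2) lift_right(2) cor_comult_lm_x cor_comult_x_rho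
          lm_closed x_closed rho_closed assoc_right_ct)
  then show "tensor_lift Z (\<lambda>x1 x2. tensor_lift Z (\<lambda>x11 x12. t3 x11 (PE.ct x12 x2)) (cor_comult PE.X x1))
      (cor_comult PE.X m) = tensor_lift Z (\<lambda>x1 x2. t3 x1 (cor_comult PE.X x2)) (cor_comult PE.X m)"
    by (simp add: assoc_right_def)
  note counit_left = X.ctensor_lift_add_hom[OF PE.X_abelian_group counit_left_balanced]
    X.ctensor_lift_ctens[OF PE.X_abelian_group counit_left_balanced]
  \<comment> \<open>On b \<rho>(a): \<epsilon>(b x) \<rho>(a) = b \<rho>(a), since \<epsilon>(x) =
    1.\<close>
  have "tensor_lift PE.X (\<lambda>y z. lm (id_counit y) z) (cor_comult PE.X m) = m"
    by (rule M_eqI[OF ab_groups(3) add_hom_comp[OF PE.cor_comult_add_hom counit_left(1)[simplified]]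
          add_hom_ident _ m])
       (simp add: cor_comult_rho counit_left(2) lm_closed x_closed rho_closed id_counit_lm id_counit_rho x_def)
  then show "tensor_lift PE.X (\<lambda>x1 x2. cor_counit PE.X x1 \<odot>\<^bsub>PE.X\<^esub> x2) (cor_comult PE.X m) = m"
    by (simp add: PE.cor_counit_eq)
  note counit_right = X.ctensor_lift_add_hom[OF PE.X_abelian_group counit_right_balanced]
    X.ctensor_lift_ctens[OF PE.X_abelian_group counit_right_balanced]
  \<comment> \<open>On b \<rho>(a): (b x) \<epsilon>(\<rho> a) = b x a = b \<rho>(a).\<close>
  have "tensor_lift PE.X (\<lambda>y z. PE.right_mult y (id_counit z)) (cor_comult PE.X m) = m"
    by (rule M_eqI[OF ab_groups(3) add_hom_comp[OF PE.cor_comult_add_hom counit_right(1)[simplified]]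
          add_hom_ident _ m])
       (simp add: cor_comult_rho counit_right(2) lm_closed x_closed rho_closed id_counit_rho PE.right_mult_lm right_mult_x)
  then show "tensor_lift PE.X (\<lambda>x1 x2. rsmult PE.X x1 (cor_counit PE.X x2)) (cor_comult PE.X m) = m"
    by (simp add: PE.cor_counit_eq)
qed (use X.lsmult_closed X.lsmult_l_distr X.lsmult_r_distr X.lsmult_assoc X.lsmult_one
       X.rsmult_closed X.rsmult_l_distr X.rsmult_r_distr X.rsmult_assoc X.rsmult_one X.bimodule
     in \<open>simp_all add: PE.cor_comult_lm cor_comult_rm PE.cor_counit_eq id_counit_lm id_counit_rm\<close>)

section \<open>The grouplike element and the Galois condition\<close>

lemma grouplike_x: "grouplike A PE.X x"
  using cor_comult_x_rho[of "\<one>\<^bsub>A\<^esub>"] id_counit_rho[of "\<one>\<^bsub>A\<^esub>"]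
  by (simp add: grouplike_def x_closed PE.cor_counit_eq flip: x_def)

lemma coinvariants_x: "coinvariants A PE.X x = {a \<in> carrier A. \<rho> a = lm a (\<rho> \<one>\<^bsub>A\<^esub>)}"
proof -
  have "lm a x = PE.right_mult x a \<longleftrightarrow> \<rho> a = lm a (\<rho> \<one>\<^bsub>A\<^esub>)" if "a \<in> carrier A" for a
    unfolding right_mult_x[OF that] unfolding x_def by (rule eq_commute)
  then show ?thesis
    by (simp add: coinvariants_def cong: conj_cong)
qed

text \<open>Since a x a' = a \<rho>(a'), the given \<open>can\<close> is already the canonical map
  of the coring. Only the base changes, from \<open>B\<close> with \<open>i\<close> to the
  coinvariants with the inclusion, and the tensor product sees just the common image.\<close>

lemma galois_coring_x:
  assumes "coinvariants A PE.X x = i ` carrier B"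
  shows "galois_coring A PE.X x"
proof -
  let ?B = "A\<lparr>carrier := coinvariants A PE.X x\<rparr>"
  have "(\<lambda>b. b) ` carrier ?B = i ` carrier B"
    using assms by simp
  note eq = ext_tensor_image_cong[OF this]
  have "\<exists>can \<in> iso (add_monoid (ext_tensor ?B A (\<lambda>b. b))) (add_monoid PE.X).
      \<forall>a \<in> carrier A. \<forall>a' \<in> carrier A.
        can (ext_tens ?B A (\<lambda>b. b) a a') = PE.right_mult (lm a x) a'"
  proof (intro bexI[of _ can] ballI)
    show "can \<in> iso (add_monoid (ext_tensor ?B A (\<lambda>b. b))) (add_monoid PE.X)"
      using can_iso by (simp add: iso_def hom_def eq)
  qed (simp add: eq can_ext_tens PE.right_mult_lm right_mult_x x_closed)
  then show ?thesis
    by (simp add: galois_coring_def Let_def coring grouplike_x)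
qed

end

lemma galois_extension_imp_galois_coring:
  assumes A: "k_algebra k A" and i: "\<And>b. b \<in> carrier B \<Longrightarrow> i b \<in> carrier A"
    and gal: "galois_extension k C B A i"
  shows "\<exists>\<psi> x. entwining_structure k A C \<psi> \<and>
       grouplike A (entwining_coring k A C \<psi>) x \<and>
       coinvariants A (entwining_coring k A C \<psi>) x = i ` carrier B \<and>
       galois_coring A (entwining_coring k A C \<psi>) x"
proof -
  obtain \<rho> can where \<rho>: "right_comodule k C A \<rho>"
    and can: "can \<in> iso (add_monoid (ext_tensor B A i)) (add_monoid (ktensor k A C))"
      "\<And>a a'. \<lbrakk>a \<in> carrier A; a' \<in> carrier A\<rbrakk> \<Longrightarrow>
         can (ext_tens B A i a a') = left_mult_tensor k A C a (\<rho> a')"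
    and coinv: "i ` carrier B = {a \<in> carrier A. \<rho> a = left_mult_tensor k A C a (\<rho> \<one>\<^bsub>A\<^esub>)}"
    using gal by (auto simp: galois_extension_def)
  interpret G: galois_coaction k A C \<rho> B i can
    using A \<rho> i can
    by (intro galois_coaction.intro galois_coaction_axioms.intro algebra_coalgebra.intro)
       (auto simp: right_comodule_def)
  have "coinvariants A (entwining_coring k A C G.psi) G.x = i ` carrier B"
    by (simp add: G.coinvariants_x coinv)
  then show ?thesis
    using G.entwining G.grouplike_x G.galois_coring_x by blast
qed

theorem proposition5p2:
  fixes k :: "('k, 'p) ring_scheme"
    and A :: "('k, 'a) module" and B :: "('k, 'b) module"
    and C :: "('k, 'c) coalgebra" and i :: "'b \<Rightarrow> 'a"
  assumes "cring k"
    and "k_algebra k A" and "k_algebra k B"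
    and "k_algebra_hom k B A i"
    and "coalgebra k C"
  shows "galois_extension k C B A i \<longleftrightarrow>
    (\<exists>\<psi> x. entwining_structure k A C \<psi> \<and>
       grouplike A (entwining_coring k A C \<psi>) x \<and>
       coinvariants A (entwining_coring k A C \<psi>) x = i ` carrier B \<and>
       galois_coring A (entwining_coring k A C \<psi>) x)"
proof
  have "\<And>b. b \<in> carrier B \<Longrightarrow> i b \<in> carrier A"
    using assms(4) by (auto simp: k_algebra_hom_def intro: ring_hom_closed)
  then show "galois_extension k C B A i \<Longrightarrow> \<exists>\<psi> x. entwining_structure k A C \<psi> \<and>
       grouplike A (entwining_coring k A C \<psi>) x \<and>
       coinvariants A (entwining_coring k A C \<psi>) x = i ` carrier B \<and>
       galois_coring A (entwining_coring k A C \<psi>) x"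
    by (rule galois_extension_imp_galois_coring[OF assms(2)])
qed (blast intro: entwining_pre_entwining pre_entwining.galois_coring_imp_galois_extension)

end
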